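(* Let $G$ be a reductive group over an algebraically closed field. Let $H$ be a subgroup of $G$ that is Zariski-dense in $G$ and consists only of semisimple elements. Then any split spherical $BN$-pair $(B,N)$ of $H$ is trivial, i.e. satisfies $B=H$.
   Context: Reductive groups are connected by definition; algebraic groups over an algebraically closed field are linear algebraic groups, identified with their groups of points. A $BN$-pair of a group $H$ is a pair of subgroups $(B,N)$ generating $H$ such that $T:=B\cap N$ is normal in $N$ and $W:=N/T$ admits a generating set $S$ with, for all $s\in S$, $w\in W$: (BN1) $sBw\subseteq BswB\cup BwB$, and (BN2) $sBs^{-1}\not\leq B$. (Then $(W,S)$ is a Coxeter system, called the type of the $BN$-pair.) The $BN$-pair is spherical if $W$ is finite. It is saturated if $B\cap N=\bigcap_{w\in W}wBw^{-1}$. It is split if it is saturated and $B=U\rtimes T$ for some nilpotent subgroup $U$ (normal in $B$). It is trivial if $B=H$. *)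

theory Defs
  imports
    "Jordan_Normal_Form.Matrix"
    "HOL-Algebra.Generated_Groups"
    "HOL-Computational_Algebra.Polynomial"
    "HOL-Analysis.Abstract_Topology"
begin

section \<open>Linear algebraic groups\<close>

definition GL :: "nat \<Rightarrow> 'k::field mat monoid" where
  "GL n = units_of (ring_mat TYPE('k) n ())"

lemma group_GL: "group (GL n :: 'k::field mat monoid)"
  unfolding GL_def
  by (intro monoid.units_group ring.is_monoid ring_mat)

lemma carrier_GL:
  "carrier (GL n :: 'k::field mat monoid) =
     {A \<in> carrier_mat n n. \<exists>B \<in> carrier_mat n n. B * A = 1\<^sub>m n \<and> A * B = 1\<^sub>m n}"
  by (auto simp: GL_def units_of_def Units_def ring_mat_def)

lemma mult_GL: "x \<otimes>\<^bsub>GL n\<^esub> y = x * y"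
  and one_GL: "\<one>\<^bsub>GL n\<^esub> = 1\<^sub>m n"
  by (simp_all add: GL_def units_of_def ring_mat_def)

text \<open>Functions of an \<open>n \<times> n\<close> matrix that are given by a polynomial in its \<open>n\<^sup>2\<close> entries.\<close>

inductive polynomial_function :: "nat \<Rightarrow> ('k::field mat \<Rightarrow> 'k) \<Rightarrow> bool" for n where
  const: "polynomial_function n (\<lambda>A. c)"
| entry: "i < n \<Longrightarrow> j < n \<Longrightarrow> polynomial_function n (\<lambda>A. A $$ (i, j))"
| add: "polynomial_function n p \<Longrightarrow> polynomial_function n q \<Longrightarrow> polynomial_function n (\<lambda>A. p A + q A)"
| mult: "polynomial_function n p \<Longrightarrow> polynomial_function n q \<Longrightarrow> polynomial_function n (\<lambda>A. p A * q A)"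

text \<open>
  The Zariski topology on \<open>GL n\<close>. Its closed sets are the zero loci in \<open>GL n\<close> of sets of polynomials
  in the matrix entries; allowing also \<open>1/det\<close> as a coordinate does not give more closed sets,
  since a power of \<open>det\<close> clears denominators.
\<close>

definition zariski :: "nat \<Rightarrow> 'k::field mat topology" where
  "zariski n = topology (\<lambda>V. \<exists>P. (\<forall>p\<in>P. polynomial_function n p) \<and>
     V = carrier (GL n) - {A \<in> carrier (GL n). \<forall>p\<in>P. p A = 0})"

lemma openin_zariski:
  "openin (zariski n) V \<longleftrightarrow> (\<exists>P. (\<forall>p\<in>P. polynomial_function n p) \<and>
     V = carrier (GL n) - {A \<in> carrier (GL n). \<forall>p\<in>P. p A = 0})"
proof -
  define L :: "'a mat set \<Rightarrow> bool" where "L = (\<lambda>V. \<exists>P. (\<forall>p\<in>P. polynomial_function n p) \<and>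
     V = carrier (GL n) - {A \<in> carrier (GL n). \<forall>p\<in>P. p A = 0})"
  have "istopology L"
    unfolding istopology_def
  proof (intro conjI allI impI)
    fix S T assume "L S" "L T"
    then obtain P Q where
      P: "\<forall>p\<in>P. polynomial_function n p"
         "S = carrier (GL n) - {A \<in> carrier (GL n). \<forall>p\<in>P. p A = 0}" and
      Q: "\<forall>p\<in>Q. polynomial_function n p"
         "T = carrier (GL n) - {A \<in> carrier (GL n). \<forall>p\<in>Q. p A = 0}"
      unfolding L_def by (elim exE conjE)
    let ?R = "{\<lambda>A. p A * q A | p q. p \<in> P \<and> q \<in> Q}"
    have "\<forall>r\<in>?R. polynomial_function n r"
      using P(1) Q(1) by (auto intro: polynomial_function.mult)
    moreover have "S \<inter> T = carrier (GL n) - {A \<in> carrier (GL n). \<forall>r\<in>?R. r A = 0}"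
    proof (intro equalityI subsetI)
      fix A assume "A \<in> S \<inter> T"
      then obtain p q where *: "A \<in> carrier (GL n)" "p \<in> P" "q \<in> Q" "p A \<noteq> 0" "q A \<noteq> 0"
        unfolding P(2) Q(2) by auto
      then have "(\<lambda>A. p A * q A) \<in> ?R" "p A * q A \<noteq> 0" by auto
      then have "\<not> (\<forall>r\<in>?R. r A = 0)" by fastforce
      with *(1) show "A \<in> carrier (GL n) - {A \<in> carrier (GL n). \<forall>r\<in>?R. r A = 0}" by simp
    next
      fix A assume "A \<in> carrier (GL n) - {A \<in> carrier (GL n). \<forall>r\<in>?R. r A = 0}"
      then obtain p q where "A \<in> carrier (GL n)" "p \<in> P" "q \<in> Q" "p A * q A \<noteq> 0" by auto
      then show "A \<in> S \<inter> T" unfolding P(2) Q(2) by auto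
    qed
    ultimately show "L (S \<inter> T)" unfolding L_def by blast
  next
    fix K assume "\<forall>V\<in>K. L V"
    then have "\<exists>P. \<forall>V\<in>K. (\<forall>p\<in>P V. polynomial_function n p) \<and>
            V = carrier (GL n) - {A \<in> carrier (GL n). \<forall>p\<in>P V. p A = 0}"
      unfolding L_def by (rule bchoice)
    then obtain P where
      "\<forall>V\<in>K. (\<forall>p\<in>P V. polynomial_function n p) \<and>
            V = carrier (GL n) - {A \<in> carrier (GL n). \<forall>p\<in>P V. p A = 0}" ..
    note P = bspec[OF this]
    have "A \<in> \<Union>K \<longleftrightarrow> A \<in> carrier (GL n) - {A \<in> carrier (GL n). \<forall>p\<in>(\<Union>V\<in>K. P V). p A = 0}" for A
    proof -
      have "A \<in> V \<longleftrightarrow> A \<in> carrier (GL n) \<and> (\<exists>p\<in>P V. p A \<noteq> 0)" if "V \<in> K" for V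
      proof -
        have "A \<in> V \<longleftrightarrow> A \<in> carrier (GL n) - {A \<in> carrier (GL n). \<forall>p\<in>P V. p A = 0}"
          using P[OF that] by simp
        then show ?thesis by blast
      qed
      then show ?thesis by auto
    qed
    then have "\<Union>K = carrier (GL n) - {A \<in> carrier (GL n). \<forall>p\<in>(\<Union>V\<in>K. P V). p A = 0}"
      unfolding set_eq_iff ..
    moreover have "\<forall>p\<in>(\<Union>V\<in>K. P V). polynomial_function n p" using P by blast
    ultimately show "L (\<Union>K)" unfolding L_def by blast
  qed
  then have "openin (zariski n) = L" unfolding zariski_def L_def by (rule topology_inverse')
  then show ?thesis by (simp add: L_def)
qed

lemma topspace_zariski: "topspace (zariski n) = carrier (GL n)"
proof
  show "topspace (zariski n) \<subseteq> carrier (GL n)"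
    unfolding topspace_def by (auto simp: openin_zariski)
  have "\<forall>p\<in>{\<lambda>A::'a mat. 1::'a}. polynomial_function n p"
    by (auto intro: polynomial_function.const)
  moreover have "carrier (GL n) = carrier (GL n) - {A \<in> carrier (GL n). \<forall>p\<in>{\<lambda>A::'a mat. 1::'a}. p A = 0}"
    by auto
  ultimately have "openin (zariski n) (carrier (GL n) :: 'a mat set)"
    unfolding openin_zariski by blast
  then show "carrier (GL n) \<subseteq> (topspace (zariski n) :: 'a mat set)" by (rule openin_subset)
qed

lemma closedin_zariski:
  "closedin (zariski n) C \<longleftrightarrow> (\<exists>P. (\<forall>p\<in>P. polynomial_function n p) \<and>
     C = {A \<in> carrier (GL n). \<forall>p\<in>P. p A = 0})"
proof -
  have diff: "C \<subseteq> X \<and> X - C = X - Z \<longleftrightarrow> C = Z" if "Z \<subseteq> X" for X Z :: "'a mat set"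
    using that by auto
  have conj_ex: "(R \<and> (\<exists>P. X P \<and> Y P)) \<longleftrightarrow> (\<exists>P. X P \<and> (R \<and> Y P))"
    for R and X Y :: "('a mat \<Rightarrow> 'a) set \<Rightarrow> bool"
    by blast
  have eq: "C \<subseteq> carrier (GL n) \<and> carrier (GL n) - C = carrier (GL n) - {A \<in> carrier (GL n). \<forall>p\<in>P. p A = 0}
    \<longleftrightarrow> C = {A \<in> carrier (GL n). \<forall>p\<in>P. p A = 0}" for P :: "('a mat \<Rightarrow> 'a) set"
    by (rule diff) auto
  have "closedin (zariski n) C \<longleftrightarrow> (\<exists>P. (\<forall>p\<in>P. polynomial_function n p) \<and>
     (C \<subseteq> carrier (GL n) \<and>
      carrier (GL n) - C = carrier (GL n) - {A \<in> carrier (GL n). \<forall>p\<in>P. p A = 0}))"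
    unfolding closedin_def topspace_zariski openin_zariski
    by (rule conj_ex)
  then show ?thesis unfolding eq .
qed

definition linear_algebraic_group :: "nat \<Rightarrow> 'k::field mat set \<Rightarrow> bool" where
  "linear_algebraic_group n G \<longleftrightarrow> subgroup G (GL n) \<and> closedin (zariski n) G"

definition zariski_dense_in :: "nat \<Rightarrow> 'k::field mat set \<Rightarrow> 'k mat set \<Rightarrow> bool" where
  "zariski_dense_in n H G \<longleftrightarrow> subtopology (zariski n) G closure_of H = G"

text \<open>Over an algebraically closed field, semisimple matrices are the diagonalizable ones.\<close>

definition semisimple_mat :: "'k::alg_closed_field mat \<Rightarrow> bool" where
  "semisimple_mat A \<longleftrightarrow> (\<exists>D. diagonal_mat D \<and> similar_mat A D)"

definition unipotent_mat :: "nat \<Rightarrow> 'k::field mat \<Rightarrow> bool" where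
  "unipotent_mat n A \<longleftrightarrow> A \<in> carrier_mat n n \<and> (\<exists>m. (A - 1\<^sub>m n) ^\<^sub>m m = 0\<^sub>m n n)"

definition unipotent_radical :: "nat \<Rightarrow> 'k::alg_closed_field mat set \<Rightarrow> 'k mat set" where
  "unipotent_radical n G = generate (GL n)
     (\<Union>{V. closedin (zariski n) V \<and> connectedin (zariski n) V \<and>
            V \<lhd> (GL n\<lparr>carrier := G\<rparr>) \<and> (\<forall>A\<in>V. unipotent_mat n A)})"

definition reductive_group :: "nat \<Rightarrow> 'k::alg_closed_field mat set \<Rightarrow> bool" where
  "reductive_group n G \<longleftrightarrow> linear_algebraic_group n G \<and> connectedin (zariski n) G \<and>
     unipotent_radical n G = {\<one>\<^bsub>GL n\<^esub>}"

section \<open>Nilpotent groups\<close>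

fun lower_central_series :: "('a, 'b) monoid_scheme \<Rightarrow> nat \<Rightarrow> 'a set" where
  "lower_central_series G 0 = carrier G"
| "lower_central_series G (Suc i) = generate G
     {x \<otimes>\<^bsub>G\<^esub> y \<otimes>\<^bsub>G\<^esub> inv\<^bsub>G\<^esub> x \<otimes>\<^bsub>G\<^esub> inv\<^bsub>G\<^esub> y | x y. x \<in> carrier G \<and> y \<in> lower_central_series G i}"

definition nilpotent_group :: "('a, 'b) monoid_scheme \<Rightarrow> bool" where
  "nilpotent_group G \<longleftrightarrow> group G \<and> (\<exists>c. lower_central_series G c = {\<one>\<^bsub>G\<^esub>})"

section \<open>$BN$-pairs\<close>

definition weyl_group :: "('a, 'b) monoid_scheme \<Rightarrow> 'a set \<Rightarrow> 'a set \<Rightarrow> 'a set monoid" where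
  "weyl_group H B N = (H\<lparr>carrier := N\<rparr>) Mod (B \<inter> N)"

text \<open>
  Elements of \<open>weyl_group H B N\<close> are cosets \<open>nT\<close> with \<open>T = B \<inter> N \<subseteq> B\<close>, so set products such as
  \<open>s <#> B <#> w\<close> and \<open>s <#> B <#> set_inv s\<close> equal the corresponding products formed with
  representatives of \<open>s\<close> and \<open>w\<close> in \<open>N\<close>.
\<close>

locale bn_pair = group H for H :: "('a, 'b) monoid_scheme" (structure) +
  fixes B N :: "'a set"
  assumes subgroup_B: "subgroup B H"
    and subgroup_N: "subgroup N H"
    and generate_BN: "generate H (B \<union> N) = carrier H"
    and T_normal: "(B \<inter> N) \<lhd> (H\<lparr>carrier := N\<rparr>)"
    and ex_generators: "\<exists>S \<subseteq> carrier (weyl_group H B N).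
      generate (weyl_group H B N) S = carrier (weyl_group H B N) \<and>
      (\<forall>s\<in>S. \<forall>w\<in>carrier (weyl_group H B N).
         s <#> B <#> w \<subseteq> (B <#> (s \<otimes>\<^bsub>weyl_group H B N\<^esub> w) <#> B) \<union> (B <#> w <#> B)) \<and>
      (\<forall>s\<in>S. \<not> s <#> B <#> set_inv s \<subseteq> B)"

definition spherical_bn_pair :: "('a, 'b) monoid_scheme \<Rightarrow> 'a set \<Rightarrow> 'a set \<Rightarrow> bool" where
  "spherical_bn_pair H B N \<longleftrightarrow> bn_pair H B N \<and> finite (carrier (weyl_group H B N))"

definition saturated_bn_pair :: "('a, 'b) monoid_scheme \<Rightarrow> 'a set \<Rightarrow> 'a set \<Rightarrow> bool" where
  "saturated_bn_pair H B N \<longleftrightarrow> bn_pair H B N \<and>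
     B \<inter> N = (\<Inter>w\<in>carrier (weyl_group H B N). w <#>\<^bsub>H\<^esub> B <#>\<^bsub>H\<^esub> set_inv\<^bsub>H\<^esub> w)"

definition split_bn_pair :: "('a, 'b) monoid_scheme \<Rightarrow> 'a set \<Rightarrow> 'a set \<Rightarrow> bool" where
  "split_bn_pair H B N \<longleftrightarrow> saturated_bn_pair H B N \<and>
     (\<exists>U. U \<lhd> (H\<lparr>carrier := B\<rparr>) \<and> nilpotent_group (H\<lparr>carrier := U\<rparr>) \<and>
          U <#>\<^bsub>H\<^esub> (B \<inter> N) = B \<and> U \<inter> (B \<inter> N) = {\<one>\<^bsub>H\<^esub>})"

end

theory Submission
  imports Defs "HOL-Algebra.Multiplicative_Group" "Jordan_Normal_Form.Char_Poly"
begin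

text \<open>
  Write \<open>B = UT\<close> with \<open>T = B \<inter> N\<close>. The point is that the center of \<open>U\<close> is central in \<open>H\<close>. For \<open>s\<close> in this
  center, the \<open>B\<close>-conjugates of \<open>s\<close> are commuting diagonalizable matrices with the eigenvalues of \<open>s\<close>,
  so there are only finitely many of them. By the Bruhat decomposition every element of \<open>H\<close> is a product
  \<open>u r b\<close> with \<open>r\<close> in a finite subset of \<open>N\<close>, and since \<open>u\<close> commutes with \<open>s\<close>, the characteristic polynomial
  of the commutator \<open>s\<^sup>-\<^sup>1 g s g\<^sup>-\<^sup>1\<close> takes only finitely many values for \<open>g \<in> H\<close>. As \<open>G\<close> is connected and \<open>H\<close> dense,
  it is constant, so these commutators are unipotent; being semisimple, they are trivial.
  By saturation central elements of \<open>H\<close> in \<open>B\<close> lie in \<open>T\<close>, so the nilpotent group \<open>U\<close> has trivial center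
  and is trivial. Thus \<open>B = T\<close> is normal in \<open>N\<close>, and (BN2) leaves no generators of the Weyl group.
\<close>

section \<open>Nilpotent groups and BN-pairs\<close>

lemma lower_central_series_subset:
  assumes "group G"
  shows "lower_central_series G i \<subseteq> carrier G"
proof (induction i)
  case (Suc i)
  interpret group G by fact
  have "generate G {x \<otimes>\<^bsub>G\<^esub> y \<otimes>\<^bsub>G\<^esub> inv\<^bsub>G\<^esub> x \<otimes>\<^bsub>G\<^esub> inv\<^bsub>G\<^esub> y | x y.
      x \<in> carrier G \<and> y \<in> lower_central_series G i} \<subseteq> carrier G"
    using Suc by (intro generate_incl) blast
  then show ?case by simp
qed simp

text \<open>Triviality climbs the lower central series: if term \<open>Suc i\<close> is trivial, all
  elements of term \<open>i\<close> are central, so \<open>center\<close> makes term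
  \<open>i\<close> trivial too. Term 0 is the group itself.\<close>

lemma nilpotent_group_trivial_center:
  assumes nil: "nilpotent_group G"
    and center: "\<And>z. z \<in> carrier G \<Longrightarrow> (\<And>x. x \<in> carrier G \<Longrightarrow> x \<otimes>\<^bsub>G\<^esub> z = z \<otimes>\<^bsub>G\<^esub> x) \<Longrightarrow> z = \<one>\<^bsub>G\<^esub>"
  shows "carrier G = {\<one>\<^bsub>G\<^esub>}"
proof -
  interpret group G using nil by (simp add: nilpotent_group_def)
  obtain c where "lower_central_series G c = {\<one>\<^bsub>G\<^esub>}"
    using nil by (auto simp: nilpotent_group_def)
  then show ?thesis
  proof (induction c)
    case (Suc i)
    have "y = \<one>\<^bsub>G\<^esub>" if y: "y \<in> lower_central_series G i" for y
    proof (rule center)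
      show yG: "y \<in> carrier G"
        using y lower_central_series_subset[OF is_group] by blast
      fix x assume x: "x \<in> carrier G"
      have "x \<otimes>\<^bsub>G\<^esub> y \<otimes>\<^bsub>G\<^esub> inv\<^bsub>G\<^esub> x \<otimes>\<^bsub>G\<^esub> inv\<^bsub>G\<^esub> y \<in> lower_central_series G (Suc i)"
        using x y by (auto intro!: generate.incl)
      then have "x \<otimes>\<^bsub>G\<^esub> y \<otimes>\<^bsub>G\<^esub> inv\<^bsub>G\<^esub> x \<otimes>\<^bsub>G\<^esub> inv\<^bsub>G\<^esub> y = \<one>\<^bsub>G\<^esub>"
        using Suc.prems by simp
      then show "x \<otimes>\<^bsub>G\<^esub> y = y \<otimes>\<^bsub>G\<^esub> x"
        using x yG by (metis inv_closed inv_equality inv_inv inv_solve_right' m_closed)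
    qed
    moreover have "\<one>\<^bsub>G\<^esub> \<in> lower_central_series G i"
      by (cases i) (auto intro: generate.one)
    ultimately have "lower_central_series G i = {\<one>\<^bsub>G\<^esub>}" by blast
    then show ?case by (rule Suc.IH)
  qed simp
qed

section \<open>Double cosets, the Bruhat decomposition, and consequences of (BN2) and
  saturation\<close>

context bn_pair
begin

lemma BN_carrier: "b \<in> B \<Longrightarrow> b \<in> carrier H" "n \<in> N \<Longrightarrow> n \<in> carrier H"
  using subgroup.subset[OF subgroup_B] subgroup.subset[OF subgroup_N] by auto

lemma weyl_group_carrier: "carrier (weyl_group H B N) = (\<lambda>n. (B \<inter> N) #> n) ` N"
  unfolding weyl_group_def carrier_FactGroup by (simp add: r_coset_def)

lemma weyl_group_subset: "w \<in> carrier (weyl_group H B N) \<Longrightarrow> w \<subseteq> N"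
  unfolding weyl_group_carrier r_coset_def
  using subgroup.m_closed[OF subgroup_N] by auto

lemma weyl_group_mult: "v \<otimes>\<^bsub>weyl_group H B N\<^esub> w = v <#> w"
  unfolding weyl_group_def by (simp add: set_mult_def)

lemma group_weyl_group: "group (weyl_group H B N)"
  unfolding weyl_group_def by (rule normal.factorgroup_is_group[OF T_normal])

lemma weyl_group_rep: "n \<in> N \<Longrightarrow> n \<in> (B \<inter> N) #> n"
  unfolding r_coset_def
  using subgroup.one_closed[OF subgroup_B] subgroup.one_closed[OF subgroup_N] BN_carrier(2)
  by (auto intro!: bexI[of _ \<one>])

definition BNB :: "'a set" where
  "BNB = {b \<otimes> n \<otimes> b' | b n b'. b \<in> B \<and> n \<in> N \<and> b' \<in> B}"

lemma BNB_carrier: "BNB \<subseteq> carrier H"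
  unfolding BNB_def using BN_carrier by auto

lemma B_mult_BNB:
  assumes "b \<in> B" "x \<in> BNB" shows "b \<otimes> x \<in> BNB"
proof -
  obtain c n c' where x: "x = c \<otimes> n \<otimes> c'" "c \<in> B" "n \<in> N" "c' \<in> B"
    using assms(2) unfolding BNB_def by blast
  then have "b \<otimes> x = (b \<otimes> c) \<otimes> n \<otimes> c'" using assms(1) by (simp add: BN_carrier m_assoc)
  then show ?thesis
    using x assms(1) subgroup.m_closed[OF subgroup_B] unfolding BNB_def by blast
qed

lemma BNB_mult_B:
  assumes "b \<in> B" "x \<in> BNB" shows "x \<otimes> b \<in> BNB"
proof -
  obtain c n c' where x: "x = c \<otimes> n \<otimes> c'" "c \<in> B" "n \<in> N" "c' \<in> B"
    using assms(2) unfolding BNB_def by blast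
  then have "x \<otimes> b = c \<otimes> n \<otimes> (c' \<otimes> b)" using assms(1) by (simp add: BN_carrier m_assoc)
  then show ?thesis
    using x assms(1) subgroup.m_closed[OF subgroup_B] unfolding BNB_def by blast
qed

lemma double_coset_subset_BNB: "w \<in> carrier (weyl_group H B N) \<Longrightarrow> B <#> w <#> B \<subseteq> BNB"
  unfolding set_mult_def BNB_def using weyl_group_subset by fastforce

text \<open>Left multiplication by \<open>B\<close> and by \<open>N\<close> preserves
  \<open>BNB\<close>, which contains the identity, and \<open>B\<close> and \<open>N\<close>
  generate the group. For \<open>N\<close> it suffices to treat the generators in \<open>S\<close>
  by (BN1); finiteness of the Weyl group takes care of their inverses.\<close>

lemma bruhat_decomposition:
  assumes fin: "finite (carrier (weyl_group H B N))"
  shows "carrier H = BNB"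
proof -
  let ?W = "weyl_group H B N"
  interpret W: group ?W by (rule group_weyl_group)
  obtain S where S: "S \<subseteq> carrier ?W" "generate ?W S = carrier ?W"
    and BN1: "\<forall>s\<in>S. \<forall>w\<in>carrier ?W. s <#> B <#> w \<subseteq> (B <#> (s \<otimes>\<^bsub>?W\<^esub> w) <#> B) \<union> (B <#> w <#> B)"
    using ex_generators by auto
  \<comment> \<open>Stability is demanded of all representatives of a coset at once, so that it can
    be proved by induction over \<open>generate ?W S\<close>.\<close>
  define stab where "stab = (\<lambda>w. \<forall>n\<in>w. \<forall>x\<in>BNB. n \<otimes> x \<in> BNB)"
  have one: "stab \<one>\<^bsub>?W\<^esub>"
    unfolding stab_def weyl_group_def using B_mult_BNB by simp
  have mult: "stab (v \<otimes>\<^bsub>?W\<^esub> w)" if "v \<in> carrier ?W" "w \<in> carrier ?W" "stab v" "stab w" for v w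
    unfolding stab_def
  proof (intro ballI)
    fix n x assume n: "n \<in> v \<otimes>\<^bsub>?W\<^esub> w" and x: "x \<in> BNB"
    obtain a b where ab: "n = a \<otimes> b" "a \<in> v" "b \<in> w"
      using n unfolding weyl_group_mult set_mult_def by blast
    moreover have "a \<in> carrier H" "b \<in> carrier H" "x \<in> carrier H"
      using that ab x weyl_group_subset BN_carrier BNB_carrier by blast+
    ultimately have "n \<otimes> x = a \<otimes> (b \<otimes> x)" by (simp add: m_assoc)
    then show "n \<otimes> x \<in> BNB" using that ab x unfolding stab_def by simp
  qed
  have gen: "stab s" if s: "s \<in> S" for s
    unfolding stab_def
  proof (intro ballI)
    fix n x assume n: "n \<in> s" and "x \<in> BNB"
    then obtain b m b' where x: "x = b \<otimes> m \<otimes> b'" "b \<in> B" "m \<in> N" "b' \<in> B"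
      unfolding BNB_def by blast
    let ?w = "(B \<inter> N) #> m"
    have w: "?w \<in> carrier ?W" using x weyl_group_carrier by blast
    have sW: "s \<in> carrier ?W" using S(1) s by blast
    \<comment> \<open>(BN1) for \<open>s\<close> and the coset of \<open>m\<close> places this
      product in one of two double cosets; the remaining factor \<open>b'\<close> is absorbed on the
      right.\<close>
    have "n \<otimes> b \<otimes> m \<in> s <#> B <#> ?w"
      using n x weyl_group_rep unfolding set_mult_def by blast
    then have "n \<otimes> b \<otimes> m \<in> BNB"
      using BN1 s w sW double_coset_subset_BNB[OF w] double_coset_subset_BNB[OF W.m_closed[OF sW w]] by blast
    moreover have "n \<in> N" using n sW weyl_group_subset by blast
    ultimately show "n \<otimes> x \<in> BNB"
      using BNB_mult_B[of b' "n \<otimes> b \<otimes> m"] x by (simp add: BN_carrier m_assoc)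
  qed
  have pow: "stab (s [^]\<^bsub>?W\<^esub> k)" if s: "s \<in> S" for s and k :: nat
  proof -
    have "s \<in> carrier ?W" using S(1) s by blast
    then show ?thesis
      by (induction k) (use one in simp, use mult gen[OF s] in auto)
  qed
  have stab_W: "stab w" if "w \<in> carrier ?W" for w
    using that unfolding S(2)[symmetric]
  proof induction
    case one then show ?case by fact
  next
    case (incl h) then show ?case by (rule gen)
  next
    case (inv s)
    \<comment> \<open>The subgroup generated by \<open>s\<close> is finite, so \<open>s\<^sup>-\<^sup>1\<close> is a power of \<open>s\<close>.\<close>
    have s: "s \<in> carrier ?W" using S(1) inv by blast
    have "inv\<^bsub>?W\<^esub> s \<in> generate ?W {s}" by (auto intro: generate.inv)
    then obtain k :: nat where "inv\<^bsub>?W\<^esub> s = s [^]\<^bsub>?W\<^esub> k"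
      using W.generate_pow_on_finite_carrier[OF fin s] by auto
    then show ?case using pow[OF inv] by simp
  next
    case (eng h1 h2)
    then show ?case using mult W.generate_in_carrier[OF S(1)] by blast
  qed
  have "\<one> \<otimes> \<one> \<otimes> \<one> \<in> BNB"
    unfolding BNB_def using subgroup.one_closed[OF subgroup_B] subgroup.one_closed[OF subgroup_N] by blast
  then have one_BNB: "\<one> \<in> BNB" by simp
  have N: "n \<otimes> x \<in> BNB" if "n \<in> N" "x \<in> BNB" for n x
    using stab_W[of "(B \<inter> N) #> n"] that weyl_group_rep weyl_group_carrier unfolding stab_def by blast
  have "\<forall>x\<in>BNB. h \<otimes> x \<in> BNB" if "h \<in> generate H (B \<union> N)" for h
    using that
  proof induction
    case one then show ?case using BNB_carrier by auto
  next
    case (incl h) then show ?case using N B_mult_BNB by blast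
  next
    case (inv h)
    then have "inv h \<in> B \<union> N"
      using subgroup.m_inv_closed[OF subgroup_B] subgroup.m_inv_closed[OF subgroup_N] by blast
    then show ?case using N B_mult_BNB by blast
  next
    case (eng h1 h2)
    have "h1 \<in> carrier H" "h2 \<in> carrier H"
      using eng generate_BN by auto
    then show ?case using eng BNB_carrier by (simp add: m_assoc subset_iff)
  qed
  \<comment> \<open>Take \<open>x\<close> to be the identity.\<close>
  then have "h \<in> BNB" if "h \<in> carrier H" for h
    using that one_BNB generate_BN by (metis r_one)
  then show ?thesis using BNB_carrier by blast
qed

text \<open>Here \<open>B\<close> equals \<open>B \<inter> N\<close>, which is normal in
  \<open>N\<close>, so (BN2) fails for every element of the Weyl group. Hence \<open>S\<close> is
  empty, the Weyl group is trivial, \<open>N\<close> lies in \<open>B\<close>, and \<open>B\<close>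
  alone generates the group.\<close>

lemma trivial_if_B_le_N:
  assumes "B \<subseteq> N"
  shows "B = carrier H"
proof -
  let ?W = "weyl_group H B N"
  interpret W: group ?W by (rule group_weyl_group)
  interpret N: group "H\<lparr>carrier := N\<rparr>"
    using subgroup.subgroup_is_group[OF subgroup_N is_group] .
  obtain S where S: "S \<subseteq> carrier ?W" "generate ?W S = carrier ?W"
    and BN2: "\<forall>s\<in>S. \<not> s <#> B <#> set_inv s \<subseteq> B"
    using ex_generators by auto
  have BN: "B \<inter> N = B" using assms by blast
  have conj: "n \<otimes> b \<otimes> inv n \<in> B" if n: "n \<in> N" and b: "b \<in> B" for n b
    using normal.inv_op_closed2[OF T_normal, of n b] that assms m_inv_consistent[OF subgroup_N n]
    by (auto simp: BN)
  have "s <#> B <#> set_inv s \<subseteq> B" if s: "s \<in> carrier ?W" for s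
  proof
    fix x assume "x \<in> s <#> B <#> set_inv s"
    then obtain m b m' where x: "x = m \<otimes> b \<otimes> inv m'" "m \<in> s" "b \<in> B" "m' \<in> s"
      unfolding set_mult_def SET_INV_def by blast
    obtain n where n: "n \<in> N" "s = B #> n" using s unfolding weyl_group_carrier BN by blast
    obtain c c' where c: "m = c \<otimes> n" "c \<in> B" "m' = c' \<otimes> n" "c' \<in> B"
      using x n unfolding r_coset_def by blast
    \<comment> \<open>\<open>m\<close> and \<open>m'\<close> may be different representatives of
      \<open>s\<close>; they differ from \<open>n\<close> by factors in \<open>B\<close>, so only
      conjugation by \<open>n\<close> matters.\<close>
    have "x = c \<otimes> (n \<otimes> b \<otimes> inv n) \<otimes> inv c'"
      using x c n by (simp add: BN_carrier inv_mult_group m_assoc)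
    then show "x \<in> B"
      using c conj[OF n(1) x(3)] subgroup.m_closed[OF subgroup_B] subgroup.m_inv_closed[OF subgroup_B]
      by simp
  qed
  then have "S = {}" using BN2 S(1) by blast
  then have "carrier ?W = {B}"
    using S(2) W.generate_empty by (simp add: weyl_group_def BN)
  then have "N \<subseteq> B"
    using weyl_group_rep weyl_group_carrier BN by (metis image_eqI singletonD subsetI)
  then have "carrier H = generate H B" using generate_BN by (simp add: Un_absorb2)
  then show ?thesis using generate_subgroup_incl[OF _ subgroup_B] subgroup.subset[OF subgroup_B] by auto
qed

lemma central_in_T:
  assumes sat: "B \<inter> N = (\<Inter>w\<in>carrier (weyl_group H B N). w <#> B <#> set_inv w)"
    and z: "z \<in> B" "\<And>x. x \<in> carrier H \<Longrightarrow> x \<otimes> z = z \<otimes> x"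
  shows "z \<in> N"
proof -
  have "z \<in> w <#> B <#> set_inv w" if w: "w \<in> carrier (weyl_group H B N)" for w
  proof -
    obtain n where n: "n \<in> N" "n \<in> w"
      using w weyl_group_rep unfolding weyl_group_carrier by blast
    have "n \<otimes> z \<otimes> inv n \<in> w <#> B <#> set_inv w"
      using n z(1) unfolding set_mult_def SET_INV_def by blast
    moreover have "n \<otimes> z \<otimes> inv n = z"
      using n z by (simp add: BN_carrier m_assoc)
    ultimately show ?thesis by simp
  qed
  then show ?thesis using sat by blast
qed

end

text \<open>The group-theoretic half of the argument. The hypothesis \<open>central\<close> isolates
  what linear algebra has to supply: the center of \<open>U\<close> is central in \<open>H\<close>,
  so by saturation it lies in \<open>B \<inter> N\<close>, which meets \<open>U\<close>
  trivially.\<close>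

lemma split_bn_pair_trivial:
  assumes split: "split_bn_pair H B N"
    and central: "\<And>U z x. \<lbrakk>U \<lhd> H\<lparr>carrier := B\<rparr>; U <#>\<^bsub>H\<^esub> (B \<inter> N) = B; z \<in> U;
        \<And>u. u \<in> U \<Longrightarrow> u \<otimes>\<^bsub>H\<^esub> z = z \<otimes>\<^bsub>H\<^esub> u; x \<in> carrier H\<rbrakk> \<Longrightarrow> x \<otimes>\<^bsub>H\<^esub> z = z \<otimes>\<^bsub>H\<^esub> x"
  shows "B = carrier H"
proof -
  interpret bn_pair H B N
    using split unfolding split_bn_pair_def saturated_bn_pair_def by blast
  have sat: "B \<inter> N = (\<Inter>w\<in>carrier (weyl_group H B N). w <#>\<^bsub>H\<^esub> B <#>\<^bsub>H\<^esub> set_inv\<^bsub>H\<^esub> w)"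
    using split unfolding split_bn_pair_def saturated_bn_pair_def by blast
  obtain U where U: "U \<lhd> H\<lparr>carrier := B\<rparr>" "nilpotent_group (H\<lparr>carrier := U\<rparr>)"
    "U <#>\<^bsub>H\<^esub> (B \<inter> N) = B" "U \<inter> (B \<inter> N) = {\<one>\<^bsub>H\<^esub>}"
    using split unfolding split_bn_pair_def by blast
  have UB: "U \<subseteq> B" using subgroup.subset[OF normal_imp_subgroup[OF U(1)]] by simp
  have "carrier (H\<lparr>carrier := U\<rparr>) = {\<one>\<^bsub>H\<lparr>carrier := U\<rparr>\<^esub>}"
  proof (rule nilpotent_group_trivial_center[OF U(2)])
    fix z assume z: "z \<in> carrier (H\<lparr>carrier := U\<rparr>)"
      "\<And>x. x \<in> carrier (H\<lparr>carrier := U\<rparr>) \<Longrightarrow> x \<otimes>\<^bsub>H\<lparr>carrier := U\<rparr>\<^esub> z = z \<otimes>\<^bsub>H\<lparr>carrier := U\<rparr>\<^esub> x"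
    then have "z \<in> N"
      using UB central[OF U(1,3)] by (intro central_in_T[OF sat]) auto
    then show "z = \<one>\<^bsub>H\<lparr>carrier := U\<rparr>\<^esub>" using z(1) UB U(4) by auto
  qed
  then have "U = {\<one>\<^bsub>H\<^esub>}" by simp
  then have "B = {\<one>\<^bsub>H\<^esub>} <#>\<^bsub>H\<^esub> (B \<inter> N)" using U(3) by simp
  also have "\<dots> \<subseteq> N" unfolding set_mult_def using BN_carrier by auto
  finally show ?thesis by (rule trivial_if_B_le_N)
qed

section \<open>Commuting semisimple matrices\<close>

text \<open>Induction on \<open>\<mu> e\<close>, which abstracts the rank. A member \<open>g\<close>
  of \<open>E\<close> other than zero and \<open>e\<close> splits \<open>e\<close> into
  \<open>g\<close> and its complement, both of smaller rank, and each \<open>f\<close> in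
  \<open>E\<close> is the sum of its parts below these two.\<close>

lemma (in ring) finite_commuting_idempotents_below:
  fixes \<mu> :: "'a \<Rightarrow> nat"
  assumes add: "\<And>e f. \<lbrakk>e \<in> carrier R; f \<in> carrier R; e \<otimes> e = e; f \<otimes> f = f; e \<otimes> f = f; f \<otimes> e = f\<rbrakk>
      \<Longrightarrow> \<mu> e = \<mu> f + \<mu> (e \<ominus> f)"
    and pos: "\<And>e. \<lbrakk>e \<in> carrier R; e \<otimes> e = e; e \<noteq> \<zero>\<rbrakk> \<Longrightarrow> \<mu> e > 0"
    and e: "e \<in> carrier R" "e \<otimes> e = e"
    and E: "\<And>f. f \<in> E \<Longrightarrow> f \<in> carrier R \<and> f \<otimes> f = f \<and> e \<otimes> f = f \<and> f \<otimes> e = f"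
    and comm: "\<And>f g. f \<in> E \<Longrightarrow> g \<in> E \<Longrightarrow> f \<otimes> g = g \<otimes> f"
  shows "finite E"
  using e E comm
proof (induction "\<mu> e" arbitrary: e E rule: less_induct)
  case less
  show ?case
  proof (cases "E \<subseteq> {\<zero>, e}")
    case True
    then show ?thesis by (rule finite_subset) simp
  next
    case False
    then obtain g where g: "g \<in> E" "g \<noteq> \<zero>" "g \<noteq> e" by blast
    note gE = less.prems(3)[OF g(1)]
    define h where "h = e \<ominus> g"
    have h: "h \<in> carrier R"
      using gE less.prems(1) unfolding h_def by simp
    have "e = h \<oplus> g" using gE less.prems(1) unfolding h_def by algebra
    then have h0: "h \<noteq> \<zero>" using g(3) gE by auto
    have hh: "h \<otimes> h = h"
    proof -
      have "h \<otimes> h = (e \<otimes> e \<ominus> e \<otimes> g) \<ominus> (g \<otimes> e \<ominus> g \<otimes> g)"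
        using gE less.prems(1) unfolding h_def by algebra
      also have "\<dots> = (e \<ominus> g) \<ominus> (g \<ominus> g)" using gE less.prems(2) by simp
      also have "\<dots> = h" using gE less.prems(1) unfolding h_def by algebra
      finally show ?thesis .
    qed
    have "\<mu> e = \<mu> g + \<mu> h"
      unfolding h_def using gE less.prems by (intro add) auto
    \<comment> \<open>Both parts are nonzero, so each has positive rank and the other one is
      strictly smaller than \<open>e\<close>.\<close>
    then have \<mu>: "\<mu> g < \<mu> e" "\<mu> h < \<mu> e"
      using pos[of g] pos[of h] gE g(2) h h0 hh by auto
    have prod: "(f \<otimes> k) \<otimes> (f' \<otimes> k) = (f \<otimes> f') \<otimes> k"
      if "f \<in> carrier R" "f' \<in> carrier R" "k \<in> carrier R" "k \<otimes> k = k" "f' \<otimes> k = k \<otimes> f'" for f f' k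
    proof -
      have "(f \<otimes> k) \<otimes> (f' \<otimes> k) = f \<otimes> (k \<otimes> f') \<otimes> k"
        using that(1-3) by (simp add: m_assoc)
      also have "\<dots> = (f \<otimes> f') \<otimes> (k \<otimes> k)"
        unfolding that(5)[symmetric] using that(1-3) by (simp add: m_assoc)
      finally show ?thesis using that(4) by simp
    qed
    \<comment> \<open>The induction hypothesis, applied to the commuting idempotents
      \<open>f \<otimes> k\<close> below \<open>k\<close>; it is needed for \<open>g\<close> and for
      its complement \<open>h\<close>.\<close>
    have below: "finite ((\<lambda>f. f \<otimes> k) ` E)"
      if k: "k \<in> carrier R" "k \<otimes> k = k" "\<mu> k < \<mu> e" "\<And>f. f \<in> E \<Longrightarrow> f \<otimes> k = k \<otimes> f" for k
    proof (rule less.hyps[OF k(3,1,2)])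
      fix f assume "f \<in> (\<lambda>f. f \<otimes> k) ` E"
      then obtain f' where f': "f' \<in> E" "f = f' \<otimes> k" by blast
      note f'E = less.prems(3)[OF f'(1)]
      have "k \<otimes> (f' \<otimes> k) = f' \<otimes> k"
        using f'E k(1,2) k(4)[OF f'(1)] by (metis m_assoc)
      moreover have "(f' \<otimes> k) \<otimes> k = f' \<otimes> k"
        using f'E k(1,2) by (simp add: m_assoc)
      ultimately show "f \<in> carrier R \<and> f \<otimes> f = f \<and> k \<otimes> f = f \<and> f \<otimes> k = f"
        using f'E k prod[of f' f' k] k(4)[OF f'(1)] unfolding f'(2) by simp
    next
      fix f f' assume "f \<in> (\<lambda>f. f \<otimes> k) ` E" "f' \<in> (\<lambda>f. f \<otimes> k) ` E"
      then obtain a b where ab: "a \<in> E" "f = a \<otimes> k" "b \<in> E" "f' = b \<otimes> k" by blast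
      then show "f \<otimes> f' = f' \<otimes> f"
        using prod[of a b k] prod[of b a k] k less.prems(3)[of a] less.prems(3)[of b] less.prems(4)[of a b]
        by simp
    qed
    have "finite ((\<lambda>f. f \<otimes> g) ` E)"
      using gE \<mu> less.prems(4) g(1) by (intro below) auto
    moreover have "finite ((\<lambda>f. f \<otimes> h) ` E)"
    proof (rule below[OF h hh \<mu>(2)])
      fix f assume "f \<in> E"
      then have f: "f \<in> carrier R" "e \<otimes> f = f" "f \<otimes> e = f" "f \<otimes> g = g \<otimes> f"
        using less.prems(3)[of f] less.prems(4)[of f g] g(1) by auto
      have "f \<otimes> h = f \<otimes> e \<ominus> f \<otimes> g" "h \<otimes> f = e \<otimes> f \<ominus> g \<otimes> f"
        using gE less.prems(1) f(1) unfolding h_def by algebra+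
      then show "f \<otimes> h = h \<otimes> f" using f by simp
    qed
    moreover have "E \<subseteq> (\<lambda>(a, b). a \<oplus> b) ` ((\<lambda>f. f \<otimes> g) ` E \<times> (\<lambda>f. f \<otimes> h) ` E)"
    proof
      fix f assume f: "f \<in> E"
      note fE = less.prems(3)[OF f]
      have "f \<otimes> g \<oplus> f \<otimes> h = f \<otimes> e"
        using fE gE less.prems(1) unfolding h_def by algebra
      then have "f = f \<otimes> g \<oplus> f \<otimes> h" using fE by simp
      then show "f \<in> (\<lambda>(a, b). a \<oplus> b) ` ((\<lambda>f. f \<otimes> g) ` E \<times> (\<lambda>f. f \<otimes> h) ` E)"
        using f by force
    qed
    ultimately show ?thesis
      by (meson finite_SigmaI finite_imageI finite_subset)
  qed
qed

text \<open>
  The rank of an idempotent \<open>e\<close> is the multiplicity of the root 1 of its characteristic polynomial.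
  It is additive because \<open>(X - f) (X - (e - f)) = X (X - e)\<close> for \<open>f\<close> below \<open>e\<close>.
\<close>

lemma char_poly_idempotent_split:
  fixes e f :: "'k::field mat"
  assumes e: "e \<in> carrier_mat n n" and f: "f \<in> carrier_mat n n"
    and ff: "f * f = f" and ef: "e * f = f" and fe: "f * e = f"
  shows "char_poly f * char_poly (e - f) = [:0, 1:] ^ n * char_poly e"
proof -
  let ?c = "map_mat (\<lambda>a::'k. [:a:])"
  let ?X = "[:0, 1:] \<cdot>\<^sub>m 1\<^sub>m n :: 'k poly mat"
  interpret c: ring_hom "\<lambda>a::'k. [:a:]" by unfold_locales auto
  have cpm: "char_poly_matrix a = ?X - ?c a" if "a \<in> carrier_mat n n" for a
    using that unfolding char_poly_matrix_def by (intro eq_matI) auto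
  have carr: "?c e \<in> carrier_mat n n" "?c f \<in> carrier_mat n n" "?X \<in> carrier_mat n n" using e f by auto
  have g: "e - f \<in> carrier_mat n n" using e f by auto
  have diff: "?c (e - f) = ?c e - ?c f" using e f by (intro eq_matI) auto
  have cff: "?c f * ?c f = ?c f" "?c f * ?c e = ?c f"
    using c.mat_hom_mult[OF f f] c.mat_hom_mult[OF f e] ff fe by simp_all
  have "char_poly_matrix f * char_poly_matrix (e - f) = (?X - ?c f) * (?X - (?c e - ?c f))"
    unfolding cpm[OF f] cpm[OF g] using diff by simp
  also have "\<dots> = ?X * ?X - ?X * (?c e - ?c f) - (?c f * ?X - ?c f * (?c e - ?c f))"
  proof -
    have "(A - B) * (A - C) = A * A - A * C - (B * A - B * C)"
      if "A \<in> carrier_mat n n" "B \<in> carrier_mat n n" "C \<in> carrier_mat n n" for A B C :: "'k poly mat"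
      using that by (subst minus_mult_distrib_mat[of _ n n])
        (auto simp: mult_minus_distrib_mat[of _ n n _ n] intro!: minus_carrier_mat)
    then show ?thesis using carr by (metis minus_carrier_mat)
  qed
  also have "?c f * (?c e - ?c f) = 0\<^sub>m n n"
    using carr cff by (simp add: mult_minus_distrib_mat[of _ n n])
  \<comment> \<open>\<open>?X\<close> is a scalar matrix, so the two terms containing
    \<open>?c f\<close> cancel.\<close>
  also have "?X * ?X - ?X * (?c e - ?c f) - (?c f * ?X - 0\<^sub>m n n) = [:0, 1:] \<cdot>\<^sub>m (?X - ?c e)"
  proof -
    have "?X * A = [:0, 1:] \<cdot>\<^sub>m A" "A * ?X = [:0, 1:] \<cdot>\<^sub>m A" if "A \<in> carrier_mat n n" for A
      using that by (simp_all add: mult_smult_distrib[OF that one_carrier_mat]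
          mult_smult_assoc_mat[OF one_carrier_mat that])
    note this[OF carr(2)] this(1)[OF carr(3)] this(1)[OF minus_carrier_mat[OF carr(2), of "?c e"]]
    then show ?thesis
      using e f by (simp only:) (intro eq_matI; auto simp: algebra_simps)
  qed
  also have "?X - ?c e = char_poly_matrix e" using cpm[OF e] by simp
  finally have "det (char_poly_matrix f * char_poly_matrix (e - f)) = [:0, 1:] ^ n * det (char_poly_matrix e)"
    using carrier_matD[OF char_poly_matrix_closed[OF e]] by (simp add: det_smult)
  then show ?thesis
    unfolding char_poly_def
    using det_mult[OF char_poly_matrix_closed[OF f] char_poly_matrix_closed[OF g]] by simp
qed

text \<open>Any nonzero column of \<open>e\<close> is an eigenvector.\<close>

lemma eigenvalue_of_mat_mult:
  fixes t e :: "'k::field mat"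
  assumes t: "t \<in> carrier_mat n n" and e: "e \<in> carrier_mat n n" and te: "t * e = \<kappa> \<cdot>\<^sub>m e"
    and nz: "e \<noteq> 0\<^sub>m n n"
  shows "eigenvalue t \<kappa>"
proof -
  obtain i j where ij: "i < n" "j < n" "e $$ (i, j) \<noteq> 0"
    using e nz by (metis carrier_matD eq_matI index_zero_mat)
  have "t *\<^sub>v col e j = col (t * e) j" using t e ij by (intro col_mult2[symmetric]) auto
  also have "\<dots> = \<kappa> \<cdot>\<^sub>v col e j" using e ij unfolding te by (intro eq_vecI) auto
  finally have "t *\<^sub>v col e j = \<kappa> \<cdot>\<^sub>v col e j" .
  moreover have "col e j \<noteq> 0\<^sub>v n" using e ij by (metis carrier_matD index_col index_zero_vec(1))
  ultimately show ?thesis unfolding eigenvalue_def eigenvector_def using t e by (intro exI[of _ "col e j"]) auto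
qed

text \<open>The ring-theoretic finiteness applied below the identity matrix, with the order of 1 as
  a root of the characteristic polynomial as rank.\<close>

lemma finite_commuting_idempotents:
  fixes E :: "'k::field mat set"
  assumes E: "\<And>f. f \<in> E \<Longrightarrow> f \<in> carrier_mat n n \<and> f * f = f"
    and comm: "\<And>f g. f \<in> E \<Longrightarrow> g \<in> E \<Longrightarrow> f * g = g * f"
  shows "finite E"
proof -
  define R where "R = ring_mat TYPE('k) n ()"
  interpret ring R unfolding R_def by (rule ring_mat)
  note R = ring_mat_simps[of "TYPE('k)" n "()", folded R_def]
  have minus: "e \<ominus>\<^bsub>R\<^esub> f = e - f" if "e \<in> carrier_mat n n" "f \<in> carrier_mat n n" for e f
  proof -
    have "\<ominus>\<^bsub>R\<^esub> f = - f"
      using that by (intro minus_equality) (auto simp: R)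
    then show ?thesis using that by (simp add: minus_eq R add_uminus_minus_mat)
  qed
  have nz: "char_poly e \<noteq> 0" if "e \<in> carrier_mat n n" for e :: "'k mat"
    using degree_monic_char_poly[OF that] by auto
  show ?thesis
  proof (rule finite_commuting_idempotents_below[of "\<lambda>e. order 1 (char_poly e)" "1\<^sub>m n"])
    fix e f assume *: "e \<in> carrier R" "f \<in> carrier R" "e \<otimes>\<^bsub>R\<^esub> f = f" "f \<otimes>\<^bsub>R\<^esub> e = f" "f \<otimes>\<^bsub>R\<^esub> f = f"
    then have c: "e \<in> carrier_mat n n" "f \<in> carrier_mat n n" "e - f \<in> carrier_mat n n" by (auto simp: R)
    have "char_poly f * char_poly (e - f) = [:0, 1:] ^ n * char_poly e"
      using * by (intro char_poly_idempotent_split) (auto simp: R)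
    \<comment> \<open>The factor \<open>X^n\<close> does not vanish at 1, so it leaves the order
      there unchanged.\<close>
    moreover have "order 1 ([:0, 1:] ^ n :: 'k poly) = 0"
      by (rule order_0I) simp
    moreover have "char_poly f * char_poly (e - f) \<noteq> 0" "[:0, 1:] ^ n * char_poly e \<noteq> 0"
      using nz c by auto
    ultimately show "order 1 (char_poly e) = order 1 (char_poly f) + order 1 (char_poly (e \<ominus>\<^bsub>R\<^esub> f))"
      using c minus by (metis add_0 order_mult)
  next
    fix e assume *: "e \<in> carrier R" "e \<otimes>\<^bsub>R\<^esub> e = e" "e \<noteq> \<zero>\<^bsub>R\<^esub>"
    then have e: "e \<in> carrier_mat n n" "e * e = e" "e \<noteq> 0\<^sub>m n n" by (auto simp: R)
    have "eigenvalue e 1" using e by (intro eigenvalue_of_mat_mult[OF e(1) e(1)]) auto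
    then show "0 < order 1 (char_poly e)"
      using eigenvalue_root_char_poly[OF e(1)] order_root[of "char_poly e"] nz[OF e(1)] by auto
  next
    fix f assume "f \<in> E"
    then show "f \<in> carrier R \<and> f \<otimes>\<^bsub>R\<^esub> f = f \<and> 1\<^sub>m n \<otimes>\<^bsub>R\<^esub> f = f \<and> f \<otimes>\<^bsub>R\<^esub> 1\<^sub>m n = f"
      using E[of f] by (auto simp: R)
  qed (use comm in \<open>auto simp: R\<close>)
qed

section \<open>Diagonalization and spectral projections\<close>

lemma mult_diagonal_mat:
  fixes X D :: "'k::field mat"
  assumes D: "diagonal_mat D" "D \<in> carrier_mat n n" and X: "X \<in> carrier_mat n n" and ij: "i < n" "j < n"
  shows "(X * D) $$ (i, j) = X $$ (i, j) * D $$ (j, j)" "(D * X) $$ (i, j) = D $$ (i, i) * X $$ (i, j)"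
proof -
  have "(X * D) $$ (i, j) = (\<Sum>k\<in>{0..<n}. X $$ (i, k) * D $$ (k, j))"
    using D(2) X ij by (simp add: scalar_prod_def)
  also have "\<dots> = (\<Sum>k\<in>{0..<n}. if k = j then X $$ (i, k) * D $$ (k, j) else 0)"
    using D ij by (intro sum.cong) (auto simp: diagonal_mat_def)
  finally show "(X * D) $$ (i, j) = X $$ (i, j) * D $$ (j, j)" using ij by simp
  have "(D * X) $$ (i, j) = (\<Sum>k\<in>{0..<n}. D $$ (i, k) * X $$ (k, j))"
    using D(2) X ij by (simp add: scalar_prod_def)
  also have "\<dots> = (\<Sum>k\<in>{0..<n}. if k = i then D $$ (i, k) * X $$ (k, j) else 0)"
    using D ij by (intro sum.cong) (auto simp: diagonal_mat_def)
  finally show "(D * X) $$ (i, j) = D $$ (i, i) * X $$ (i, j)" using ij by simp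
qed

text \<open>\<open>e \<kappa>\<close> is the projection onto the \<open>\<kappa>\<close>-eigenspace along the other eigenspaces.\<close>

lemma spectral_projections:
  fixes t :: "'k::alg_closed_field mat"
  assumes t: "t \<in> carrier_mat n n" and ss: "semisimple_mat t"
  obtains e :: "'k \<Rightarrow> 'k mat" where
    "\<And>\<kappa>. e \<kappa> \<in> carrier_mat n n" "\<And>\<kappa>. e \<kappa> * e \<kappa> = e \<kappa>" "\<And>\<kappa>. t * e \<kappa> = \<kappa> \<cdot>\<^sub>m e \<kappa>"
    "\<And>X \<kappa>. X \<in> carrier_mat n n \<Longrightarrow> X * t = t * X \<Longrightarrow> X * e \<kappa> = e \<kappa> * X"
    "\<And>X. X \<in> carrier_mat n n \<Longrightarrow> (\<And>\<kappa>. X * e \<kappa> = 0\<^sub>m n n) \<Longrightarrow> X = 0\<^sub>m n n"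
proof -
  obtain D P Q where D: "diagonal_mat D" and "similar_mat_wit t D P Q"
    using ss unfolding semisimple_mat_def similar_mat_def by blast
  note wit = similar_mat_witD2[OF t this(2)]
  note carr = wit(5-7)
  have PQ: "P * (Q * X) = X" "Q * (P * X) = X" if "X \<in> carrier_mat n n" for X
    using that wit(1,2) carr by (simp_all flip: assoc_mult_mat[of _ n n _ n _ n])
  \<comment> \<open>The projections in diagonal coordinates, later conjugated back by
    \<open>P\<close> and \<open>Q\<close>. They are zero when \<kappa> is not an eigenvalue, so
    \<kappa> may range over the whole field.\<close>
  define d where "d = (\<lambda>\<kappa>. mat n n (\<lambda>(i, j). if i = j \<and> D $$ (i, i) = \<kappa> then 1 else 0 :: 'k))"
  have d: "d \<kappa> \<in> carrier_mat n n" for \<kappa> by (simp add: d_def)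
  have d_entry: "d \<kappa> $$ (i, j) = (if i = j \<and> D $$ (i, i) = \<kappa> then 1 else 0)"
    if "i < n" "j < n" for i j \<kappa> using that by (simp add: d_def)
  have d_diag: "diagonal_mat (d \<kappa>)" for \<kappa> by (simp add: d_def diagonal_mat_def)
  have right: "(X * d \<kappa>) $$ (i, j) = (if D $$ (j, j) = \<kappa> then X $$ (i, j) else 0)"
    and left: "(d \<kappa> * X) $$ (i, j) = (if D $$ (i, i) = \<kappa> then X $$ (i, j) else 0)"
    if "X \<in> carrier_mat n n" "i < n" "j < n" for X \<kappa> i j
    using mult_diagonal_mat[OF d_diag d that] that by (simp_all add: d_entry del: index_mult_mat(1))
  note Dright = mult_diagonal_mat(1)[OF D carr(1)] and Dleft = mult_diagonal_mat(2)[OF D carr(1)]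
  note mc = mult_carrier_mat[of _ n n _ n]
  show thesis
  proof (rule that[of "\<lambda>\<kappa>. P * (d \<kappa> * Q)"])
    fix \<kappa>
    show "P * (d \<kappa> * Q) \<in> carrier_mat n n" using carr d by (simp add: mc)
    have "d \<kappa> * d \<kappa> = d \<kappa>" 
      using carrier_matD[OF d] by (intro eq_matI) (auto simp: left[OF d] d_entry simp del: index_mult_mat(1))
    show "P * (d \<kappa> * Q) * (P * (d \<kappa> * Q)) = P * (d \<kappa> * Q)"
    proof -
      have "P * (d \<kappa> * Q) * (P * (d \<kappa> * Q)) = P * (d \<kappa> * d \<kappa> * Q)"
        using carr d PQ by (simp add: assoc_mult_mat[of _ n n _ n _ n] mc)
      then show ?thesis using \<open>d \<kappa> * d \<kappa> = d \<kappa>\<close> by simp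
    qed
    have "D * d \<kappa> = \<kappa> \<cdot>\<^sub>m d \<kappa>"
      using carrier_matD[OF d] carr by (intro eq_matI) (auto simp: Dleft[OF d] d_entry simp del: index_mult_mat(1))
    then have "D * (d \<kappa> * Q) = \<kappa> \<cdot>\<^sub>m (d \<kappa> * Q)"
      using mult_smult_assoc_mat[OF d[of \<kappa>] carr(3), of \<kappa>] assoc_mult_mat[OF carr(1) d[of \<kappa>] carr(3)] by simp
    then show "t * (P * (d \<kappa> * Q)) = \<kappa> \<cdot>\<^sub>m (P * (d \<kappa> * Q))"
      unfolding wit(3) using carr d PQ
      by (simp add: assoc_mult_mat[of _ n n _ n _ n] mc mult_smult_distrib[of _ n n _ n])
    fix X :: "'k mat" assume X: "X \<in> carrier_mat n n"
    define Y where "Y = Q * (X * P)"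
    have Y: "Y \<in> carrier_mat n n" using X carr by (simp add: Y_def mc)
    have XP: "X * P = P * Y" and QX: "Q * X = Y * Q"
      using X carr PQ wit(1) by (simp_all add: Y_def assoc_mult_mat[of _ n n _ n _ n] mc)
    assume "X * t = t * X"
    then have "Q * (X * t * P) = Q * (t * X * P)" by simp
    then have YD: "Y * D = D * Y"
      unfolding wit(3) Y_def using X carr PQ wit(2)
      by (simp add: assoc_mult_mat[of _ n n _ n _ n] mc)
    \<comment> \<open>Comparing entries of \<open>Y * D\<close> and \<open>D * Y\<close>:
      \<open>Y\<close> does not mix different eigenvalues.\<close>
    have Y0: "Y $$ (i, j) = 0" if "i < n" "j < n" "D $$ (i, i) \<noteq> D $$ (j, j)" for i j
      using arg_cong[OF YD, of "\<lambda>A. A $$ (i, j)"] Dright[OF Y that(1,2)] Dleft[OF Y that(1,2)] that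
      by (simp add: mult.commute del: index_mult_mat(1))
    have "Y * d \<kappa> = d \<kappa> * Y"
    proof (rule eq_matI)
      fix i j assume "i < dim_row (d \<kappa> * Y)" "j < dim_col (d \<kappa> * Y)"
      then have "i < n" "j < n" using Y carrier_matD[OF d] by auto
      then show "(Y * d \<kappa>) $$ (i, j) = (d \<kappa> * Y) $$ (i, j)"
        unfolding left[OF Y \<open>i < n\<close> \<open>j < n\<close>] right[OF Y \<open>i < n\<close> \<open>j < n\<close>] using Y0 by auto
    qed (use Y carrier_matD[OF d] in auto)
    then have "P * (Y * d \<kappa>) * Q = P * (d \<kappa> * Y) * Q" by simp
    then have "(X * P) * (d \<kappa> * Q) = P * (d \<kappa> * (Q * X))"
      unfolding XP QX using X Y d carr by (simp add: assoc_mult_mat[of _ n n _ n _ n] mc)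
    then show "X * (P * (d \<kappa> * Q)) = P * (d \<kappa> * Q) * X"
      using X d carr by (simp add: assoc_mult_mat[of _ n n _ n _ n] mc)
  next
    \<comment> \<open>This property replaces the statement that the projections sum to the identity
      and avoids a sum over the eigenvalues.\<close>
    fix X :: "'k mat" assume X: "X \<in> carrier_mat n n" and 0: "\<And>\<kappa>. X * (P * (d \<kappa> * Q)) = 0\<^sub>m n n"
    have XP: "X * P \<in> carrier_mat n n" using X carr by (simp add: mc)
    have "X * P * d \<kappa> = 0\<^sub>m n n" for \<kappa>
    proof -
      have "X * P * d \<kappa> = X * (P * (d \<kappa> * Q)) * P"
        using X d carr wit(2) right_mult_one_mat[OF d] by (simp add: assoc_mult_mat[of _ n n _ n _ n] mc)
      then show ?thesis using 0[of \<kappa>] left_mult_zero_mat[OF carr(2)] by simp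
    qed
    \<comment> \<open>Column \<open>j\<close> survives multiplication by \<open>d \<kappa>\<close>
      when \<kappa> is the diagonal entry of \<open>D\<close> in that column.\<close>
    then have "(X * P) $$ (i, j) = 0" if "i < n" "j < n" for i j
      using right[OF XP that, of "D $$ (j, j)"] that by (simp del: index_mult_mat(1))
    then have "X * P = 0\<^sub>m n n"
      using carrier_matD[OF XP] by (intro eq_matI) (simp_all del: index_mult_mat)
    then have "X * P * Q = 0\<^sub>m n n" using carr by simp
    moreover have "X * P * Q = X"
      using X carr wit(1) by (simp add: assoc_mult_mat[of _ n n _ n _ n])
    ultimately show "X = 0\<^sub>m n n" by simp
  qed
qed

text \<open>\<open>y - 1\<close> annihilates every spectral projection of \<open>y\<close>: the one
  for 1 because \<open>y\<close> fixes it, the others because they are zero.\<close>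

lemma semisimple_mat_eq_one:
  fixes y :: "'k::alg_closed_field mat"
  assumes y: "y \<in> carrier_mat n n" "semisimple_mat y"
    and ev: "\<And>\<kappa>. eigenvalue y \<kappa> \<Longrightarrow> \<kappa> = 1"
  shows "y = 1\<^sub>m n"
proof -
  obtain e :: "'k \<Rightarrow> 'k mat" where e: "\<And>\<kappa>. e \<kappa> \<in> carrier_mat n n" "\<And>\<kappa>. y * e \<kappa> = \<kappa> \<cdot>\<^sub>m e \<kappa>"
    "\<And>X. X \<in> carrier_mat n n \<Longrightarrow> (\<And>\<kappa>. X * e \<kappa> = 0\<^sub>m n n) \<Longrightarrow> X = 0\<^sub>m n n"
    using spectral_projections[OF y] by metis
  have "(y - 1\<^sub>m n) * e \<kappa> = 0\<^sub>m n n" for \<kappa>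
  proof (cases "\<kappa> = 1")
    case True
    then have "y * e \<kappa> = e \<kappa>" using e(2)[of \<kappa>] by auto
    then show ?thesis using y e(1)[of \<kappa>] by (simp add: minus_mult_distrib_mat[of _ n n])
  next
    case False
    then have "e \<kappa> = 0\<^sub>m n n" using ev eigenvalue_of_mat_mult[OF y(1) e(1,2)] by blast
    then show ?thesis using y by (simp add: minus_mult_distrib_mat[of _ n n])
  qed
  then have 0: "y - 1\<^sub>m n = 0\<^sub>m n n" by (rule e(3)[OF minus_carrier_mat[OF one_carrier_mat]])
  show ?thesis
  proof (rule eq_matI)
    fix i j assume "i < dim_row (1\<^sub>m n :: 'k mat)" "j < dim_col (1\<^sub>m n :: 'k mat)"
    then show "y $$ (i, j) = 1\<^sub>m n $$ (i, j)"
      using arg_cong[OF 0, of "\<lambda>A. A $$ (i, j)"] y(1) by simp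
  qed (use y in auto)
qed

text \<open>All spectral projections of all members commute, so they form a finite set
  \<open>E\<close>. A member is determined by its map from \<Lambda> to \<open>E\<close>, and there
  are finitely many such maps.\<close>

lemma finite_commuting_semisimple:
  fixes F :: "'k::alg_closed_field mat set"
  assumes F: "\<And>t. t \<in> F \<Longrightarrow> t \<in> carrier_mat n n \<and> semisimple_mat t"
    and comm: "\<And>t u. t \<in> F \<Longrightarrow> u \<in> F \<Longrightarrow> t * u = u * t"
    and fin: "finite \<Lambda>" and ev: "\<And>t \<kappa>. t \<in> F \<Longrightarrow> eigenvalue t \<kappa> \<Longrightarrow> \<kappa> \<in> \<Lambda>"
  shows "finite F"
proof -
  have "\<forall>t\<in>F. \<exists>e::'k \<Rightarrow> 'k mat. (\<forall>\<kappa>. e \<kappa> \<in> carrier_mat n n \<and> e \<kappa> * e \<kappa> = e \<kappa> \<and> t * e \<kappa> = \<kappa> \<cdot>\<^sub>m e \<kappa>) \<and>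
    (\<forall>X \<kappa>. X \<in> carrier_mat n n \<longrightarrow> X * t = t * X \<longrightarrow> X * e \<kappa> = e \<kappa> * X) \<and>
    (\<forall>X. X \<in> carrier_mat n n \<longrightarrow> (\<forall>\<kappa>. X * e \<kappa> = 0\<^sub>m n n) \<longrightarrow> X = 0\<^sub>m n n)"
  proof
    fix t assume "t \<in> F"
    then have "t \<in> carrier_mat n n" "semisimple_mat t" using F by auto
    from spectral_projections[OF this] show "\<exists>e::'k \<Rightarrow> 'k mat.
      (\<forall>\<kappa>. e \<kappa> \<in> carrier_mat n n \<and> e \<kappa> * e \<kappa> = e \<kappa> \<and> t * e \<kappa> = \<kappa> \<cdot>\<^sub>m e \<kappa>) \<and>
      (\<forall>X \<kappa>. X \<in> carrier_mat n n \<longrightarrow> X * t = t * X \<longrightarrow> X * e \<kappa> = e \<kappa> * X) \<and>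
      (\<forall>X. X \<in> carrier_mat n n \<longrightarrow> (\<forall>\<kappa>. X * e \<kappa> = 0\<^sub>m n n) \<longrightarrow> X = 0\<^sub>m n n)"
      by metis
  qed
  then obtain e :: "'k mat \<Rightarrow> 'k \<Rightarrow> 'k mat" where "\<forall>t\<in>F.
    (\<forall>\<kappa>. e t \<kappa> \<in> carrier_mat n n \<and> e t \<kappa> * e t \<kappa> = e t \<kappa> \<and> t * e t \<kappa> = \<kappa> \<cdot>\<^sub>m e t \<kappa>) \<and>
    (\<forall>X \<kappa>. X \<in> carrier_mat n n \<longrightarrow> X * t = t * X \<longrightarrow> X * e t \<kappa> = e t \<kappa> * X) \<and>
    (\<forall>X. X \<in> carrier_mat n n \<longrightarrow> (\<forall>\<kappa>. X * e t \<kappa> = 0\<^sub>m n n) \<longrightarrow> X = 0\<^sub>m n n)"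
    by (rule exE[OF bchoice])
  note * = bspec[OF this]
  have e: "e t \<kappa> \<in> carrier_mat n n" "e t \<kappa> * e t \<kappa> = e t \<kappa>" "t * e t \<kappa> = \<kappa> \<cdot>\<^sub>m e t \<kappa>"
    if "t \<in> F" for t \<kappa>
    using *[OF that] by auto
  have e_comm: "X * e t \<kappa> = e t \<kappa> * X"
    if "t \<in> F" "X \<in> carrier_mat n n" "X * t = t * X" for t X \<kappa>
    using *[OF that(1)] that(2,3) by blast
  have e_0: "X = 0\<^sub>m n n" if "t \<in> F" "X \<in> carrier_mat n n" "\<And>\<kappa>. X * e t \<kappa> = 0\<^sub>m n n" for t X
    using *[OF that(1)] that(2,3) by blast
  define E where "E = (\<Union>t\<in>F. range (e t))"
  have "finite E"
  proof (rule finite_commuting_idempotents)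
    fix f g assume "f \<in> E" "g \<in> E"
    then obtain t \<kappa> u \<mu> where fg: "t \<in> F" "f = e t \<kappa>" "u \<in> F" "g = e u \<mu>" unfolding E_def by blast
    \<comment> \<open>Two passes: \<open>u\<close> commutes with \<open>t\<close>, hence with the
      projections of \<open>t\<close>; these therefore commute with the projections of
      \<open>u\<close>.\<close>
    have "u * e t \<kappa> = e t \<kappa> * u" using fg F comm by (intro e_comm) auto
    then show "f * g = g * f" unfolding fg using e(1) fg by (intro e_comm) auto
  qed (use e in \<open>auto simp: E_def\<close>)
  then have fin': "finite (\<Lambda> \<rightarrow>\<^sub>E E)" using fin by (intro finite_PiE) auto
  have outside: "e t \<kappa> = 0\<^sub>m n n" if "t \<in> F" "\<kappa> \<notin> \<Lambda>" for t \<kappa>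
    using that ev eigenvalue_of_mat_mult[of t n "e t \<kappa>"] e F by blast
  have "inj_on (\<lambda>t. restrict (e t) \<Lambda>) F"
  proof (rule inj_onI)
    fix t u assume tu: "t \<in> F" "u \<in> F" and "restrict (e t) \<Lambda> = restrict (e u) \<Lambda>"
    then have "e t \<kappa> = e u \<kappa>" if "\<kappa> \<in> \<Lambda>" for \<kappa> using that by (metis restrict_apply)
    then have eq: "e t \<kappa> = e u \<kappa>" for \<kappa> using outside tu by metis
    have t: "t \<in> carrier_mat n n" and u: "u \<in> carrier_mat n n" using F tu by auto
    \<comment> \<open>On their common projection both matrices act as the scalar \<kappa>.\<close>
    have "(t - u) * e t \<kappa> = 0\<^sub>m n n" for \<kappa>
      using e(1,3)[OF tu(1), of \<kappa>] e(3)[OF tu(2), of \<kappa>] t u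
      by (simp add: minus_mult_distrib_mat[of _ n n] eq)
    then have 0: "t - u = 0\<^sub>m n n" using u tu(1) by (intro e_0[OF tu(1) minus_carrier_mat])
    show "t = u"
    proof (rule eq_matI)
      fix i j assume "i < dim_row u" "j < dim_col u"
      then show "t $$ (i, j) = u $$ (i, j)"
        using arg_cong[OF 0, of "\<lambda>A. A $$ (i, j)"] t u by simp
    qed (use t u in auto)
  qed
  moreover have "(\<lambda>t. restrict (e t) \<Lambda>) ` F \<subseteq> \<Lambda> \<rightarrow>\<^sub>E E" by (auto simp: E_def)
  ultimately show ?thesis using fin' by (meson finite_imageD finite_subset)
qed

section \<open>Polynomial functions on a connected group\<close>

lemma polynomial_function_sum:
  "(\<And>i. i \<in> I \<Longrightarrow> polynomial_function n (f i)) \<Longrightarrow> polynomial_function n (\<lambda>A. \<Sum>i\<in>I. f i A)"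
  by (induction I rule: infinite_finite_induct) (auto intro: polynomial_function.intros)

lemma polynomial_function_prod:
  "(\<And>i. i \<in> I \<Longrightarrow> polynomial_function n (f i)) \<Longrightarrow> polynomial_function n (\<lambda>A. \<Prod>i\<in>I. f i A)"
  by (induction I rule: infinite_finite_induct) (auto intro: polynomial_function.intros)

lemma polynomial_function_diff:
  assumes "polynomial_function n p" "polynomial_function n q"
  shows "polynomial_function n (\<lambda>A. p A - q A)"
proof -
  have "polynomial_function n (\<lambda>A. p A + (- 1) * q A)"
    using assms by (intro polynomial_function.intros)
  then show ?thesis by simp
qed

lemma polynomial_function_det:
  assumes "\<And>i j. i < m \<Longrightarrow> j < m \<Longrightarrow> polynomial_function n (\<lambda>A. f A i j)"
  shows "polynomial_function n (\<lambda>A. det (mat m m (\<lambda>(i, j). f A i j)))"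
proof -
  have "det (mat m m (\<lambda>(i, j). f A i j)) =
      (\<Sum>p\<in>{p. p permutes {0..<m}}. signof p * (\<Prod>i\<in>{0..<m}. f A i (p i)))" for A
    by (auto simp: det_def intro!: sum.cong arg_cong2[of _ _ _ _ "(*)"] prod.cong)
  moreover have "polynomial_function n
      (\<lambda>A. \<Sum>p\<in>{p. p permutes {0..<m}}. signof p * (\<Prod>i\<in>{0..<m}. f A i (p i)))"
    by (intro polynomial_function_sum polynomial_function.mult polynomial_function.const
        polynomial_function_prod assms) (auto simp: permutes_def permutes_in_image)
  ultimately show ?thesis by simp
qed

lemma closedin_zariski_zeros:
  "polynomial_function n p \<Longrightarrow> closedin (zariski n) {A \<in> carrier (GL n). p A = 0}"
  unfolding closedin_zariski by (intro exI[of _ "{p}"]) simp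

text \<open>The ratio of \<open>p\<close> to \<open>q\<close> takes finitely many values on
  \<open>H\<close>. By density the level sets of these values cover \<open>G\<close>; they are
  closed, and disjoint in \<open>G\<close> because \<open>q\<close> has no zero there, so
  connectedness leaves only the level \<open>c0\<close> attained at \<open>g0\<close>. Writing
  \<open>p = c * q\<close> avoids division.\<close>

lemma finitely_many_values_imp_constant:
  assumes conn: "connectedin (zariski n) G" and dense: "zariski_dense_in n H G" and HG: "H \<subseteq> G"
    and p: "polynomial_function n p" and q: "polynomial_function n q"
    and nz: "\<And>g. g \<in> G \<Longrightarrow> q g \<noteq> 0"
    and C: "finite C" "\<And>h. h \<in> H \<Longrightarrow> \<exists>c\<in>C. p h = c * q h"
    and g0: "g0 \<in> G" "p g0 = c0 * q g0" and g: "g \<in> G"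
  shows "p g = c0 * q g"
proof -
  have G: "G \<subseteq> carrier (GL n)"
    using conn connectedin_subset_topspace topspace_zariski by metis
  define X where "X = {A \<in> carrier (GL n). p A - c0 * q A = 0}"
  \<comment> \<open>The product merges all levels other than \<open>c0\<close> into the zero set of
    one polynomial.\<close>
  define Y where "Y = {A \<in> carrier (GL n). (\<Prod>c\<in>C - {c0}. p A - c * q A) = 0}"
  have X: "closedin (zariski n) X" unfolding X_def
    using p q by (intro closedin_zariski_zeros polynomial_function_diff polynomial_function.intros)
  have Y: "closedin (zariski n) Y" unfolding Y_def
    using p q by (intro closedin_zariski_zeros polynomial_function_prod polynomial_function_diff polynomial_function.intros)
  have "H \<subseteq> (X \<union> Y) \<inter> G"
  proof
    fix h assume h: "h \<in> H"
    then obtain c where "c \<in> C" "p h = c * q h" using C(2) by blast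
    then have "p h - c0 * q h = 0 \<or> (\<Prod>c\<in>C - {c0}. p h - c * q h) = 0"
      using C(1) by (cases "c = c0") auto
    then show "h \<in> (X \<union> Y) \<inter> G" using h HG G by (auto simp: X_def Y_def)
  qed
  moreover have "closedin (subtopology (zariski n) G) ((X \<union> Y) \<inter> G)"
    using X Y unfolding closedin_subtopology by blast
  ultimately have "G \<subseteq> X \<union> Y"
    using dense closure_of_minimal unfolding zariski_dense_in_def by blast
  moreover have "X \<inter> Y \<inter> G = {}"
  proof -
    have False if A: "A \<in> G" "p A - c0 * q A = 0" "(\<Prod>c\<in>C - {c0}. p A - c * q A) = 0" for A
    proof -
      obtain c where "c \<noteq> c0" "p A - c * q A = 0"
        using A(3) C(1) by auto
      then have "(c - c0) * q A = 0" using A(2) by (simp add: algebra_simps)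
      then show False using nz[OF A(1)] \<open>c \<noteq> c0\<close> by simp
    qed
    then show ?thesis by (auto simp: X_def Y_def)
  qed
  moreover have "X \<inter> G \<noteq> {}" using g0 G by (auto simp: X_def)
  ultimately have "Y \<inter> G = {}"
    using conn X Y unfolding connectedin_closedin by blast
  then have "g \<in> X" using \<open>G \<subseteq> X \<union> Y\<close> g by blast
  then show ?thesis by (simp add: X_def)
qed

section \<open>The center of $U$ is central\<close>

text \<open>The center of a normal subgroup is stable under conjugation: move \<open>u\<close> back
  by \<open>b\<close>, commute it with \<open>s\<close> inside \<open>U\<close>, and move it forward
  again.\<close>

lemma (in bn_pair) conj_center_normal:
  assumes U: "U \<lhd> H\<lparr>carrier := B\<rparr>" and s: "s \<in> U" "\<And>u. u \<in> U \<Longrightarrow> u \<otimes> s = s \<otimes> u" and b: "b \<in> B"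
  shows "b \<otimes> s \<otimes> inv b \<in> U" "\<And>u. u \<in> U \<Longrightarrow> u \<otimes> (b \<otimes> s \<otimes> inv b) = (b \<otimes> s \<otimes> inv b) \<otimes> u"
proof -
  note inv_B = m_inv_consistent[OF subgroup_B]
  have UB: "U \<subseteq> B" using subgroup.subset[OF normal_imp_subgroup[OF U]] by simp
  show "b \<otimes> s \<otimes> inv b \<in> U" using normal.inv_op_closed2[OF U, of b s] b s(1) inv_B by simp
  fix u assume u: "u \<in> U"
  then have "inv b \<otimes> u \<otimes> b \<in> U"
    using normal.inv_op_closed1[OF U, of b u] b inv_B by simp
  from s(2)[OF this] have *: "inv b \<otimes> u \<otimes> b \<otimes> s = s \<otimes> (inv b \<otimes> u \<otimes> b)" .
  have carr: "u \<in> carrier H" "s \<in> carrier H" "b \<in> carrier H" using u s(1) b UB BN_carrier by auto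
  have "u \<otimes> (b \<otimes> s \<otimes> inv b) = b \<otimes> (inv b \<otimes> u \<otimes> b \<otimes> s) \<otimes> inv b"
    using carr by (simp add: m_assoc[symmetric])
  also have "\<dots> = (b \<otimes> s \<otimes> inv b) \<otimes> u"
    unfolding * using carr by (simp add: m_assoc)
  finally show "u \<otimes> (b \<otimes> s \<otimes> inv b) = (b \<otimes> s \<otimes> inv b) \<otimes> u" .
qed

text \<open>A Bruhat decomposition whose left factor lies in \<open>U\<close>, so that it commutes
  with the center of \<open>U\<close>. The part of the left factor in \<open>B \<inter> N\<close> is
  pushed into \<open>N\<close>, and \<open>R\<close> represents the finitely many cosets.\<close>

lemma (in bn_pair) finite_double_cosets:
  assumes fin: "finite (carrier (weyl_group H B N))" and U: "U \<subseteq> B" "U <#> (B \<inter> N) = B"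
  shows "\<exists>R\<subseteq>N. finite R \<and> (\<forall>h\<in>carrier H. \<exists>u\<in>U. \<exists>r\<in>R. \<exists>b\<in>B. h = u \<otimes> r \<otimes> b)"
proof -
  have "finite ((\<lambda>n. (B \<inter> N) #> n) ` N)" using fin by (simp add: weyl_group_carrier)
  then obtain R where R: "R \<subseteq> N" "finite R" "(\<lambda>n. (B \<inter> N) #> n) ` N = (\<lambda>n. (B \<inter> N) #> n) ` R"
    using finite_subset_image by (metis order_refl)
  have "\<exists>u\<in>U. \<exists>r\<in>R. \<exists>b\<in>B. h = u \<otimes> r \<otimes> b" if hH: "h \<in> carrier H" for h
  proof -
    obtain b n b' where h: "h = b \<otimes> n \<otimes> b'" "b \<in> B" "n \<in> N" "b' \<in> B"
      using hH bruhat_decomposition[OF fin] unfolding BNB_def by blast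
    obtain u t where ut: "b = u \<otimes> t" "u \<in> U" "t \<in> B" "t \<in> N"
      using h(2) U(2) unfolding set_mult_def by blast
    have tn: "t \<otimes> n \<in> N" using ut h subgroup.m_closed[OF subgroup_N] by blast
    then obtain r where r: "r \<in> R" "(B \<inter> N) #> (t \<otimes> n) = (B \<inter> N) #> r"
      using R(3) by blast
    have rN: "r \<in> N" using r R by blast
    have "t \<otimes> n \<in> (B \<inter> N) #> r" using weyl_group_rep[OF tn] r(2) by simp
    \<comment> \<open>Normality turns the right coset into a left one, so the factor
      \<open>t'\<close> can be absorbed into \<open>B\<close> on the right.\<close>
    also have "(B \<inter> N) #> r = r <# (B \<inter> N)"
      using normal.coset_eq[OF T_normal] rN by (simp add: r_coset_def l_coset_def)
    finally obtain t' where t': "t \<otimes> n = r \<otimes> t'" "t' \<in> B" "t' \<in> N"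
      unfolding l_coset_def by blast
    have carr: "u \<in> carrier H" using ut U(1) BN_carrier by blast
    have "h = u \<otimes> (t \<otimes> n) \<otimes> b'"
      using h ut carr by (simp add: BN_carrier m_assoc)
    also have "\<dots> = u \<otimes> r \<otimes> (t' \<otimes> b')"
      using t' h rN carr by (simp add: BN_carrier m_assoc)
    finally show ?thesis
      using ut(2) r(1) t'(2) h(4) subgroup.m_closed[OF subgroup_B] by blast
  qed
  then show ?thesis using R(1,2) by (intro exI[of _ R] conjI ballI)
qed

text \<open>An element \<kappa> is an eigenvalue of the commutator of \<open>s\<close> and
  \<open>g\<close> exactly if \<open>det (g * s - \<kappa> s * g)\<close> vanishes. For \<kappa>
  other than 1, the ratio of this determinant to \<open>det g\<close> is constant and nonzero, so
  the semisimple commutator is trivial.\<close>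

lemma center_of_U_central:
  fixes G H B N U :: "'k::alg_closed_field mat set"
  assumes conn: "connectedin (zariski n) G" and HG: "H \<subseteq> G" and dense: "zariski_dense_in n H G"
    and H: "subgroup H (GL n)"
    and ss: "\<And>h. h \<in> H \<Longrightarrow> semisimple_mat h"
    and bn: "bn_pair (GL n\<lparr>carrier := H\<rparr>) B N"
    and fin: "finite (carrier (weyl_group (GL n\<lparr>carrier := H\<rparr>) B N))"
    and U: "U \<lhd> GL n\<lparr>carrier := B\<rparr>" "U <#>\<^bsub>GL n\<^esub> (B \<inter> N) = B"
    and s: "s \<in> U" "\<And>u. u \<in> U \<Longrightarrow> u * s = s * u"
    and g: "g \<in> H"
  shows "g * s = s * g"
proof -
  interpret bn_pair "GL n\<lparr>carrier := H\<rparr>" B N by fact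
  let ?H = "GL n\<lparr>carrier := H\<rparr>"
  have mult: "x \<otimes>\<^bsub>?H\<^esub> y = x * y" and one: "\<one>\<^bsub>?H\<^esub> = 1\<^sub>m n" for x y
    by (simp_all add: mult_GL one_GL)
  define i where "i = m_inv ?H"
  have U': "U \<lhd> ?H\<lparr>carrier := B\<rparr>" "U <#>\<^bsub>?H\<^esub> (B \<inter> N) = B"
    using U by (simp_all add: set_mult_def)
  have UB: "U \<subseteq> B" using subgroup.subset[OF normal_imp_subgroup[OF U(1)]] by simp
  have BH: "B \<subseteq> H" and NH: "N \<subseteq> H" using BN_carrier by auto
  have carr: "h \<in> carrier_mat n n" if "h \<in> H" for h
    using subgroup.subset[OF H] that by (auto simp: carrier_GL)
  have mH: "x * y \<in> H" if "x \<in> H" "y \<in> H" for x y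
    using m_closed[of x y] that by (simp add: mult_GL)
  have iH: "i x \<in> H" and ix: "i x * x = 1\<^sub>m n" "x * i x = 1\<^sub>m n" if "x \<in> H" for x
    using inv_closed[of x] l_inv[of x] r_inv[of x] that unfolding i_def mult one by simp_all
  note am = assoc_mult_mat[of _ n n _ n _ n] and mc = mult_carrier_mat[of _ n n _ n]
  have detG: "det x \<noteq> 0" if "x \<in> G" for x
  proof -
    have "x \<in> carrier (GL n)"
      using conn connectedin_subset_topspace topspace_zariski that by blast
    then obtain y where "x \<in> carrier_mat n n" "y \<in> carrier_mat n n" "x * y = 1\<^sub>m n"
      by (auto simp: carrier_GL)
    then have "det x * det y = 1" using det_mult[of x n y] by simp
    then show ?thesis by auto
  qed
  have sH: "s \<in> H" using s(1) UB BH by blast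
  note sc = carr[OF sH]
  define F where "F = (\<lambda>b. b * s * i b) ` B"
  have conj: "b * s * i b \<in> U" "u * (b * s * i b) = (b * s * i b) * u" if "b \<in> B" "u \<in> U" for b u
    using conj_center_normal[OF U'(1) s(1) _ that(1)] s(2) that(2) unfolding mult i_def by auto
  have F: "t \<in> U" "\<And>u. u \<in> U \<Longrightarrow> u * t = t * u" if "t \<in> F" for t
    using that conj s(1) unfolding F_def by auto
  \<comment> \<open>The conjugates of \<open>s\<close> lie in the center of \<open>U\<close>, so
    they commute with each other; they are semisimple and share the eigenvalues of
    \<open>s\<close>.\<close>
  have "finite F"
  proof (rule finite_commuting_semisimple[where \<Lambda> = "{\<kappa>. poly (char_poly s) \<kappa> = 0}" and n = n])
    show "t \<in> carrier_mat n n \<and> semisimple_mat t" if "t \<in> F" for t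
      using F(1)[OF that] UB BH carr ss by blast
    show "t * u = u * t" if "t \<in> F" "u \<in> F" for t u using F that by blast
    show "finite {\<kappa>. poly (char_poly s) \<kappa> = 0}"
      using degree_monic_char_poly[OF sc] by (intro poly_roots_finite) auto
    show "\<kappa> \<in> {\<kappa>. poly (char_poly s) \<kappa> = 0}" if t: "t \<in> F" and ev: "eigenvalue t \<kappa>" for t \<kappa>
    proof -
      obtain b where b: "b \<in> B" "t = b * s * i b" using t unfolding F_def by blast
      have bH: "b \<in> H" using b BH by blast
      have tc: "t \<in> carrier_mat n n" unfolding b(2) by (intro carr mH bH iH sH)
      have "similar_mat t s"
        using carr[OF bH] carr[OF iH[OF bH]] ix[OF bH] sc tc b(2)
        by (intro similar_matI[where P = b and Q = "i b"]) auto
      then show ?thesis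
        using ev eigenvalue_root_char_poly[OF tc, of \<kappa>] char_poly_similar[of t s] by simp
    qed
  qed
  obtain R where R: "R \<subseteq> N" "finite R"
    and *: "\<forall>h\<in>carrier ?H. \<exists>u\<in>U. \<exists>r\<in>R. \<exists>b\<in>B. h = u \<otimes>\<^bsub>?H\<^esub> r \<otimes>\<^bsub>?H\<^esub> b"
    using finite_double_cosets[OF fin UB U'(2)] by (elim exE conjE)
  have URB: "\<exists>u\<in>U. \<exists>r\<in>R. \<exists>b\<in>B. h = u * r * b" if "h \<in> H" for h
    using that * by (simp add: mult_GL)
  have one_eigenvalue: "\<kappa> = 1" if ev: "eigenvalue (i s * g * s * i g) \<kappa>" for \<kappa>
  proof (rule ccontr)
    assume \<kappa>: "\<kappa> \<noteq> 1"
    \<comment> \<open>Entries are written out to exhibit them as polynomial functions of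
      \<open>h\<close>; on square matrices this is \<open>h * s - \<kappa> s * h\<close>.\<close>
    define M where "M = (\<lambda>h. mat n n (\<lambda>(i, j).
      (\<Sum>k\<in>{0..<n}. h $$ (i, k) * s $$ (k, j)) - \<kappa> * (\<Sum>k\<in>{0..<n}. s $$ (i, k) * h $$ (k, j))))"
    have M: "M h = h * s - \<kappa> \<cdot>\<^sub>m (s * h)" if "h \<in> carrier_mat n n" for h
      using that sc unfolding M_def by (intro eq_matI) (auto simp: scalar_prod_def)
    \<comment> \<open>The determinant, rebuilt from entries so that
      \<open>polynomial_function_det\<close> applies.\<close>
    define q where "q = (\<lambda>h::'k mat. det (mat n n (\<lambda>(i, j). h $$ (i, j))))"
    have q: "q h = det h" if "h \<in> carrier_mat n n" for h
    proof -
      have "mat n n (\<lambda>(i, j). h $$ (i, j)) = h" using that by (intro eq_matI) auto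
      then show ?thesis by (simp add: q_def)
    qed
    have Gc: "h \<in> carrier_mat n n" if "h \<in> G" for h
      using conn connectedin_subset_topspace topspace_zariski that by (fastforce simp: carrier_GL)
    have M_poly: "polynomial_function n (\<lambda>h. det (M h))"
      unfolding M_def by (intro polynomial_function_det polynomial_function_diff polynomial_function_sum
          polynomial_function.intros) auto
    have q_poly: "polynomial_function n q"
      unfolding q_def by (intro polynomial_function_det polynomial_function.intros)
    have oneG: "1\<^sub>m n \<in> G" using subgroup.one_closed[OF H] HG by (auto simp: one_GL)
    \<comment> \<open>The constant is the value of the ratio at the identity matrix.\<close>
    have "det (M g) = ((1 - \<kappa>) ^ n * det s) * q g"
    proof (rule finitely_many_values_imp_constant[OF conn dense HG M_poly q_poly])
      show "q h \<noteq> 0" if "h \<in> G" for h using detG[OF that] q[OF Gc[OF that]] by simp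
      show "finite ((\<lambda>(r, t). det (r * t - \<kappa> \<cdot>\<^sub>m (s * r)) / det r) ` (R \<times> F))"
        using R(2) \<open>finite F\<close> by simp
      show "1\<^sub>m n \<in> G" by fact
      show "g \<in> G" using g HG by blast
      have "1\<^sub>m n * s - \<kappa> \<cdot>\<^sub>m (s * 1\<^sub>m n) = (1 - \<kappa>) \<cdot>\<^sub>m s"
        using sc by (intro eq_matI) (auto simp: algebra_simps)
      then show "det (M (1\<^sub>m n)) = ((1 - \<kappa>) ^ n * det s) * q (1\<^sub>m n)"
        using sc by (simp add: M q det_smult)
      fix h assume "h \<in> H"
      then obtain u r b where h: "h = u * r * b" and u: "u \<in> U" and r: "r \<in> R" and b: "b \<in> B"
        using URB by blast
      have H: "u \<in> H" "r \<in> H" "b \<in> H" "i b \<in> H" using u r b UB BH R(1) NH iH by blast+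
      note cs = carr[OF H(1)] carr[OF H(2)] carr[OF H(3)] carr[OF H(4)] sc
      define t where "t = b * s * i b"
      have t: "t \<in> carrier_mat n n" unfolding t_def using cs by (simp add: mc)
      have tb: "b * s = t * b"
        unfolding t_def using cs ix(1)[OF H(3)] by (simp add: am mc)
      have hs: "h * s = u * (r * t) * b"
      proof -
        have "h * s = u * (r * (b * s))" unfolding h using cs by (simp add: am mc)
        then show ?thesis unfolding tb using cs t by (simp add: am mc)
      qed
      have sh: "s * h = u * (s * r) * b"
      proof -
        have "s * h = (s * u) * (r * b)" unfolding h using cs by (simp add: am mc)
        then show ?thesis unfolding s(2)[OF u, symmetric] using cs by (simp add: am mc)
      qed
      have rt: "r * t \<in> carrier_mat n n" "s * r \<in> carrier_mat n n" using cs t by (simp_all add: mc)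
      \<comment> \<open>Moving \<open>s\<close> past \<open>b\<close> turns it into
        \<open>t\<close>, and moving it past \<open>u\<close> changes nothing. Up to the outer
        factors \<open>u\<close> and \<open>b\<close>, only the pair of \<open>r\<close> and
        \<open>t\<close> remains, with finitely many possibilities.\<close>
      have "M h = u * (r * t - \<kappa> \<cdot>\<^sub>m (s * r)) * b"
      proof -
        have "u * (r * t - \<kappa> \<cdot>\<^sub>m (s * r)) = u * (r * t) - u * (\<kappa> \<cdot>\<^sub>m (s * r))"
          using cs rt by (intro mult_minus_distrib_mat[of _ n n _ n]) auto
        also have "u * (\<kappa> \<cdot>\<^sub>m (s * r)) = \<kappa> \<cdot>\<^sub>m (u * (s * r))"
          using cs rt by (intro mult_smult_distrib[of _ n n _ n])
        finally have "u * (r * t - \<kappa> \<cdot>\<^sub>m (s * r)) * b = (u * (r * t) - \<kappa> \<cdot>\<^sub>m (u * (s * r))) * b" by simp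
        also have "\<dots> = u * (r * t) * b - \<kappa> \<cdot>\<^sub>m (u * (s * r)) * b"
          using cs rt by (intro minus_mult_distrib_mat[of _ n n _ _ n]) (auto simp: mc)
        also have "\<kappa> \<cdot>\<^sub>m (u * (s * r)) * b = \<kappa> \<cdot>\<^sub>m (u * (s * r) * b)"
          using cs rt by (intro mult_smult_assoc_mat[of _ n n _ n]) (auto simp: mc)
        finally show ?thesis using M[of h] carr[OF \<open>h \<in> H\<close>] hs sh by simp
      qed
      then have "det (M h) = det u * det (r * t - \<kappa> \<cdot>\<^sub>m (s * r)) * det b"
        using cs rt t by (simp add: det_mult[of _ n] mc minus_carrier_mat)
      moreover have "q h = det u * det r * det b"
        using q[OF carr[OF \<open>h \<in> H\<close>]] cs unfolding h by (simp add: det_mult[of _ n] mc)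
      moreover have "det r \<noteq> 0" using detG H(2) HG by blast
      ultimately have "det (M h) = det (r * t - \<kappa> \<cdot>\<^sub>m (s * r)) / det r * q h" by simp
      moreover have "t \<in> F" unfolding F_def t_def using b by blast
      ultimately show "\<exists>c\<in>(\<lambda>(r, t). det (r * t - \<kappa> \<cdot>\<^sub>m (s * r)) / det r) ` (R \<times> F). det (M h) = c * q h"
        using r by (intro bexI[of _ "det (r * t - \<kappa> \<cdot>\<^sub>m (s * r)) / det r"]) auto
    qed
    then have nz: "det (M g) \<noteq> 0"
      using \<kappa> detG sH g HG q[OF carr[OF g]] by auto
    note cs = carr[OF g] sc carr[OF iH[OF g]] carr[OF iH[OF sH]]
    let ?y = "i s * g * s * i g"
    have y: "?y \<in> carrier_mat n n" using cs by (simp add: mc)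
    have "det (char_matrix ?y \<kappa>) = 0" using ev eigenvalue_det[OF y] by simp
    \<comment> \<open>Multiplying by \<open>s\<close> on the left and \<open>g\<close> on the right
      clears the inverses in the commutator \<open>?y\<close>.\<close>
    moreover have "M g = s * char_matrix ?y \<kappa> * g"
    proof -
      have "char_matrix ?y \<kappa> = ?y - \<kappa> \<cdot>\<^sub>m 1\<^sub>m n"
        using y unfolding char_matrix_def by (intro eq_matI) auto
      then have "s * char_matrix ?y \<kappa> = s * ?y - s * (\<kappa> \<cdot>\<^sub>m 1\<^sub>m n)"
        using y sc by (simp add: mult_minus_distrib_mat[of _ n n _ n])
      also have "s * (\<kappa> \<cdot>\<^sub>m 1\<^sub>m n) = \<kappa> \<cdot>\<^sub>m s"
        using mult_smult_distrib[OF sc one_carrier_mat] sc by simp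
      also have "s * ?y = g * s * i g"
      proof -
        have "s * ?y = s * i s * (g * s * i g)" using cs by (simp add: am mc)
        then show ?thesis using ix[OF sH] cs by (simp add: mc)
      qed
      finally have "s * char_matrix ?y \<kappa> * g = g * s * i g * g - \<kappa> \<cdot>\<^sub>m s * g"
        using cs by (simp add: minus_mult_distrib_mat[of _ n n] mc)
      also have "\<kappa> \<cdot>\<^sub>m s * g = \<kappa> \<cdot>\<^sub>m (s * g)" using cs by (intro mult_smult_assoc_mat[of _ n n _ n])
      also have "g * s * i g * g = g * s" using cs ix(1)[OF g] by (simp add: am mc)
      finally show ?thesis using M cs by simp
    qed
    ultimately have "det (M g) = 0"
      using y cs by (simp add: det_mult[of _ n] mc)
    with nz show False by simp
  qed
  have cs: "g \<in> carrier_mat n n" "i g \<in> carrier_mat n n" "i s \<in> carrier_mat n n"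
    using g sH iH carr by auto
  have "i s * g * s * i g \<in> H" using g sH iH mH by simp
  then have "i s * g * s * i g = 1\<^sub>m n"
    using one_eigenvalue carr ss by (intro semisimple_mat_eq_one) auto
  then have "s * (i s * g * s * i g) * g = s * 1\<^sub>m n * g" by simp
  moreover have "s * (i s * g * s * i g) * g = (s * i s) * (g * s) * (i g * g)"
    using cs sc by (simp add: am mc)
  ultimately show ?thesis using ix[OF sH] ix[OF g] cs sc by (simp add: mc)
qed

theorem theorem1p3:
  fixes n :: nat and G H B N :: "'k::alg_closed_field mat set"
  assumes "reductive_group n G"
    and "subgroup H (GL n\<lparr>carrier := G\<rparr>)"
    and "zariski_dense_in n H G"
    and "\<forall>h\<in>H. semisimple_mat h"
    and "split_bn_pair (GL n\<lparr>carrier := H\<rparr>) B N"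
    and "spherical_bn_pair (GL n\<lparr>carrier := H\<rparr>) B N"
  shows "B = H"
proof -
  have G: "subgroup G (GL n)" "connectedin (zariski n) G"
    using assms(1) by (auto simp: reductive_group_def linear_algebraic_group_def)
  have HG: "H \<subseteq> G" using subgroup.subset[OF assms(2)] by simp
  have H: "subgroup H (GL n)"
    using group.incl_subgroup[OF group_GL G(1) assms(2)] .
  have bn: "bn_pair (GL n\<lparr>carrier := H\<rparr>) B N"
    and fin: "finite (carrier (weyl_group (GL n\<lparr>carrier := H\<rparr>) B N))"
    using assms(6) by (auto simp: spherical_bn_pair_def)
  have "B = carrier (GL n\<lparr>carrier := H\<rparr>)"
  \<comment> \<open>Centrality of the center of \<open>U\<close> comes from
    \<open>center_of_U_central\<close>; changing the carrier of \<open>GL n\<close> leaves the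
    multiplication unchanged.\<close>
  proof (rule split_bn_pair_trivial[OF assms(5)])
    fix U z x
    assume *: "U \<lhd> GL n\<lparr>carrier := H\<rparr>\<lparr>carrier := B\<rparr>" "U <#>\<^bsub>GL n\<lparr>carrier := H\<rparr>\<^esub> (B \<inter> N) = B"
      "z \<in> U" "\<And>u. u \<in> U \<Longrightarrow> u \<otimes>\<^bsub>GL n\<lparr>carrier := H\<rparr>\<^esub> z = z \<otimes>\<^bsub>GL n\<lparr>carrier := H\<rparr>\<^esub> u"
      "x \<in> carrier (GL n\<lparr>carrier := H\<rparr>)"
    have "x * z = z * x"
    proof (rule center_of_U_central[OF G(2) HG assms(3) H _ bn fin])
      show "U <#>\<^bsub>GL n\<^esub> (B \<inter> N) = B" using *(2) by (simp add: set_mult_def)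
    qed (use * assms(4) in \<open>auto simp: mult_GL\<close>)
    then show "x \<otimes>\<^bsub>GL n\<lparr>carrier := H\<rparr>\<^esub> z = z \<otimes>\<^bsub>GL n\<lparr>carrier := H\<rparr>\<^esub> x"
      by (simp add: mult_GL)
  qed
  then show ?thesis by simp
qed

end
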